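(* For a bipartite state $\rho_{AB}$ let $|\Psi_{ABE}\rangle$ be a purification of $\rho_{AB}$ held jointly with a system $E$, and let $Z_A$ be the outcome of the local projective measurement $\{|j_A\rangle\langle j_A|\}_{j_A=1}^{d_A}$ on $A$. Then the conditional von Neumann entropy $S(Z_A|E)$, regarded as a function of $\rho_{AB}$, is a basis-dependent discord measure with respect to $J_A=\{|j_A\rangle\}$.
   Context: $\mathcal H_A,\mathcal H_B$ are finite-dimensional complex Hilbert spaces; states are density operators; $J_A=\{|j_A\rangle\}_{j_A=1}^{d_A}$ is a fixed orthonormal basis of $\mathcal H_A$. A purification is a unit vector $|\Psi_{ABE}\rangle\in\mathcal H_A\otimes\mathcal H_B\otimes\mathcal H_E$ with $\mathrm{tr}_E|\Psi_{ABE}\rangle\langle\Psi_{ABE}|=\rho_{AB}$. $S$ is von Neumann entropy, and $$S(Z_A|E)=S(\rho_{AE}^{Adiag})-S(\rho_E),$$ where $\rho_{AE},\rho_E$ are the reduced states of $|\Psi_{ABE}\rangle$ and $\rho_{AE}^{Adiag}=\sum_{j_A}(|j_A\rangle\langle j_A|\otimes I)\rho_{AE}(|j_A\rangle\langle j_A|\otimes I)$. (This is the first term of the Devetak–Winter key rate $K=S(Z_A|E)-S(Z_A|Z_B)$ in quantum key distribution when $\rho_{AB}$ is known.) Incoherent states of $A$ are the states diagonal in $J_A$. An operator $K$ on $\mathcal H_A$ is an incoherent Kraus operator if $K\sigma K^\dagger$ is diagonal in $J_A$ for every incoherent $\sigma$; an incoherent unitary is a unitary that is an incoherent Kraus operator.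 Incoherent-quantum (IQ) states: $\sum_{j_A}p_{j_A}|j_A\rangle\langle j_A|\otimes\rho_B^{j_A}$ with $p$ a probability distribution and $\rho_B^{j_A}$ states of $B$. Separable-quantum-incoherent (SQI) operations: $\Lambda_{SQI}(\rho_{AB})=\sum_n(A_n\otimes B_n)\rho_{AB}(A_n\otimes B_n)^\dagger$ with $\sum_nA_n^\dagger A_n\otimes B_n^\dagger B_n=I$, each $A_n$ an incoherent Kraus operator on $A$ and each $B_n$ an operator on $B$. A basis-dependent discord measure is a function $BD_{J_A}$ from states of $\mathcal H_A\otimes\mathcal H_B$ to $[0,\infty)$ such that: (BD1) it vanishes on IQ states; (BD2) $BD_{J_A}(\Lambda_{SQI}(\rho_{AB}))\le BD_{J_A}(\rho_{AB})$ for all SQI operations; (BD3) it is invariant under conjugation by $U_A\otimes U_B$ with $U_A$ an incoherent unitary on $A$ and $U_B$ any unitary on $B$. *)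

theory Defs
  imports "HOL-Analysis.Analysis"
begin

text \<open>
  A Hilbert space of dimension \<open>CARD('n)\<close> is \<open>complex ^ 'n\<close>; the tensor product of
  \<open>complex ^ 'a\<close> and \<open>complex ^ 'b\<close> is \<open>complex ^ ('a \<times> 'b)\<close>. Operators are square
  matrices, with \<open>M $ i $ j\<close> the entry in row \<open>i\<close> and column \<open>j\<close>.
\<close>

type_synonym 'n operator = "complex ^ 'n ^ 'n"

text \<open>The library's inner product on \<open>complex ^ 'n\<close> is the real one, that is, the real part
  of the Hermitian inner product below (antilinear in its first argument).\<close>

definition cinner :: "complex ^ 'n::finite \<Rightarrow> complex ^ 'n \<Rightarrow> complex" where
  "cinner v w = (\<Sum>i\<in>UNIV. cnj (v $ i) * w $ i)"

definition adj :: "'n::finite operator \<Rightarrow> 'n operator" where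
  "adj M = (\<chi> i j. cnj (M $ j $ i))"

definition ketbra :: "complex ^ 'n::finite \<Rightarrow> complex ^ 'n \<Rightarrow> 'n operator" where
  "ketbra v w = (\<chi> i j. v $ i * cnj (w $ j))"

definition tensor :: "'a::finite operator \<Rightarrow> 'b::finite operator \<Rightarrow> ('a \<times> 'b) operator"
    (infixr \<open>\<otimes>\<^sub>o\<close> 75) where
  "M \<otimes>\<^sub>o N = (\<chi> p q. M $ fst p $ fst q * N $ snd p $ snd q)"

definition unitary_op :: "'n::finite operator \<Rightarrow> bool" where
  "unitary_op U \<longleftrightarrow> adj U ** U = mat 1 \<and> U ** adj U = mat 1"

definition density_operator :: "'n::finite operator \<Rightarrow> bool" where
  "density_operator \<rho> \<longleftrightarrow>
     adj \<rho> = \<rho> \<and> (\<forall>v. 0 \<le> Re (cinner v (\<rho> *v v))) \<and> trace \<rho> = 1"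

text \<open>Since there are \<open>CARD('n)\<close> many vectors \<open>J i\<close>, an orthonormal family indexed by \<open>'n\<close>
  is an orthonormal basis of \<open>complex ^ 'n\<close>.\<close>

definition orthonormal_basis :: "('n::finite \<Rightarrow> complex ^ 'n) \<Rightarrow> bool" where
  "orthonormal_basis J \<longleftrightarrow> (\<forall>i j. cinner (J i) (J j) = (if i = j then 1 else 0))"

definition eigenspace :: "'n::finite operator \<Rightarrow> complex \<Rightarrow> (complex ^ 'n) set" where
  "eigenspace M c = {v. M *v v = c *s v}"

text \<open>The entropy in bits, \<open>- tr (\<rho> log\<^sub>2 \<rho>)\<close>, of a density operator: a sum over its (real)
  eigenvalues, each counted with its multiplicity, the complex dimension \<open>vec.dim\<close> of its
  eigenspace. The convention \<open>0 log 0 = 0\<close> holds automatically.\<close>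

definition von_neumann_entropy :: "'n::finite operator \<Rightarrow> real" where
  "von_neumann_entropy \<rho> =
     - (\<Sum>x\<in>{x::real. eigenspace \<rho> (of_real x) \<noteq> {0}}.
          real (vec.dim (eigenspace \<rho> (of_real x))) * (x * log 2 x))"

definition trace_E :: "('a::finite \<times> 'b::finite \<times> 'e::finite) operator \<Rightarrow> ('a \<times> 'b) operator"
  where "trace_E M = (\<chi> p q. \<Sum>e\<in>UNIV. M $ (fst p, snd p, e) $ (fst q, snd q, e))"

definition trace_B :: "('a::finite \<times> 'b::finite \<times> 'e::finite) operator \<Rightarrow> ('a \<times> 'e) operator"
  where "trace_B M = (\<chi> p q. \<Sum>b\<in>UNIV. M $ (fst p, b, snd p) $ (fst q, b, snd q))"

definition trace_AB :: "('a::finite \<times> 'b::finite \<times> 'e::finite) operator \<Rightarrow> 'e operator"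
  where "trace_AB M = (\<chi> e e'. \<Sum>a\<in>UNIV. \<Sum>b\<in>UNIV. M $ (a, b, e) $ (a, b, e'))"

definition purification ::
    "complex ^ ('a::finite \<times> 'b::finite \<times> 'e::finite) \<Rightarrow> ('a \<times> 'b) operator \<Rightarrow> bool" where
  "purification \<Psi> \<rho> \<longleftrightarrow> norm \<Psi> = 1 \<and> trace_E (ketbra \<Psi> \<Psi>) = \<rho>"

definition dephase_A ::
    "('a::finite \<Rightarrow> complex ^ 'a) \<Rightarrow> ('a \<times> 'e::finite) operator \<Rightarrow> ('a \<times> 'e) operator" where
  "dephase_A J \<rho> =
     (\<Sum>j\<in>UNIV. (ketbra (J j) (J j) \<otimes>\<^sub>o mat 1) ** \<rho> ** (ketbra (J j) (J j) \<otimes>\<^sub>o mat 1))"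

definition entropy_Z_given_E ::
    "('a::finite \<Rightarrow> complex ^ 'a) \<Rightarrow> complex ^ ('a \<times> 'b::finite \<times> 'e::finite) \<Rightarrow> real" where
  "entropy_Z_given_E J \<Psi> =
     von_neumann_entropy (dephase_A J (trace_B (ketbra \<Psi> \<Psi>)))
       - von_neumann_entropy (trace_AB (ketbra \<Psi> \<Psi>))"

text \<open>\<open>S(Z\<^sub>A|E)\<close> as a function of the state of \<open>AB\<close>. Here \<open>E\<close> is a copy of \<open>AB\<close>, which is large
  enough to purify every state of \<open>AB\<close>, and the purification is chosen arbitrarily; that neither
  choice matters is not part of the definition.\<close>

definition S_Z_E ::
    "('a::finite \<Rightarrow> complex ^ 'a) \<Rightarrow> ('a \<times> 'b::finite) operator \<Rightarrow> real" where
  "S_Z_E J \<rho> =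
     entropy_Z_given_E J (SOME \<Psi> :: complex ^ ('a \<times> 'b \<times> ('a \<times> 'b)). purification \<Psi> \<rho>)"

definition diagonal_in :: "('n::finite \<Rightarrow> complex ^ 'n) \<Rightarrow> 'n operator \<Rightarrow> bool" where
  "diagonal_in J M \<longleftrightarrow> (\<forall>i j. i \<noteq> j \<longrightarrow> cinner (J i) (M *v J j) = 0)"

definition incoherent_state :: "('n::finite \<Rightarrow> complex ^ 'n) \<Rightarrow> 'n operator \<Rightarrow> bool" where
  "incoherent_state J \<sigma> \<longleftrightarrow> density_operator \<sigma> \<and> diagonal_in J \<sigma>"

definition incoherent_kraus :: "('n::finite \<Rightarrow> complex ^ 'n) \<Rightarrow> 'n operator \<Rightarrow> bool" where
  "incoherent_kraus J K \<longleftrightarrow>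
     (\<forall>\<sigma>. incoherent_state J \<sigma> \<longrightarrow> diagonal_in J (K ** \<sigma> ** adj K))"

definition incoherent_unitary :: "('n::finite \<Rightarrow> complex ^ 'n) \<Rightarrow> 'n operator \<Rightarrow> bool" where
  "incoherent_unitary J U \<longleftrightarrow> unitary_op U \<and> incoherent_kraus J U"

definition IQ_state ::
    "('a::finite \<Rightarrow> complex ^ 'a) \<Rightarrow> ('a \<times> 'b::finite) operator \<Rightarrow> bool" where
  "IQ_state J \<rho> \<longleftrightarrow>
     (\<exists>(p :: 'a \<Rightarrow> real) (\<tau> :: 'a \<Rightarrow> 'b operator).
        (\<forall>j. 0 \<le> p j) \<and> (\<Sum>j\<in>UNIV. p j) = 1 \<and> (\<forall>j. density_operator (\<tau> j)) \<and>
        \<rho> = (\<Sum>j\<in>UNIV. p j *\<^sub>R (ketbra (J j) (J j) \<otimes>\<^sub>o \<tau> j)))"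

definition SQI_operation ::
    "('a::finite \<Rightarrow> complex ^ 'a) \<Rightarrow>
     (('a \<times> 'b::finite) operator \<Rightarrow> ('a \<times> 'b) operator) \<Rightarrow> bool" where
  "SQI_operation J \<Lambda> \<longleftrightarrow>
     (\<exists>(N :: nat) (A :: nat \<Rightarrow> 'a operator) (B :: nat \<Rightarrow> 'b operator).
        (\<forall>n<N. incoherent_kraus J (A n)) \<and>
        (\<Sum>n<N. (adj (A n) ** A n) \<otimes>\<^sub>o (adj (B n) ** B n)) = mat 1 \<and>
        (\<forall>\<rho>. \<Lambda> \<rho> = (\<Sum>n<N. (A n \<otimes>\<^sub>o B n) ** \<rho> ** adj (A n \<otimes>\<^sub>o B n))))"

text \<open>A measure is a function on states; its values at other operators are irrelevant.\<close>

definition basis_dependent_discord_measure ::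
    "('a::finite \<Rightarrow> complex ^ 'a) \<Rightarrow> (('a \<times> 'b::finite) operator \<Rightarrow> real) \<Rightarrow> bool" where
  "basis_dependent_discord_measure J BD \<longleftrightarrow>
     (\<forall>\<rho>. density_operator \<rho> \<longrightarrow> 0 \<le> BD \<rho>) \<and>
     (\<forall>\<rho>. IQ_state J \<rho> \<longrightarrow> BD \<rho> = 0) \<and>
     (\<forall>\<Lambda> \<rho>. SQI_operation J \<Lambda> \<longrightarrow> density_operator \<rho> \<longrightarrow> BD (\<Lambda> \<rho>) \<le> BD \<rho>) \<and>
     (\<forall>U V \<rho>. incoherent_unitary J U \<longrightarrow> unitary_op V \<longrightarrow> density_operator \<rho> \<longrightarrow>
        BD ((U \<otimes>\<^sub>o V) ** \<rho> ** adj (U \<otimes>\<^sub>o V)) = BD \<rho>)"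

end

theory Submission
  imports Defs
begin

text \<open>
  Let \<open>\<Delta>\<close> be the dephasing of \<open>A\<close>. A pure state has marginals of equal entropy, and the dephased
  marginals on \<open>AE\<close> and \<open>AB\<close> are in turn the marginals of a pure state, in which the basis value of
  \<open>A\<close> is copied. Hence \<open>S(Z\<^sub>A|E) = S(\<Delta> \<rho>) - S(\<rho>)\<close>, whatever the purification. This is the
  relative entropy \<open>D(\<rho> \<parallel> \<Delta> \<rho>)\<close>. An SQI operation \<open>\<Lambda>\<close> maps dephased states to dephased states, so
  \<open>D(\<Lambda> \<rho> \<parallel> \<Delta> \<Lambda> \<rho>) \<le> D(\<Lambda> \<rho> \<parallel> \<Lambda> \<Delta> \<rho>) \<le> D(\<rho> \<parallel> \<Delta> \<rho>)\<close>, by Klein's inequality and by the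
  monotonicity of the relative entropy.

  For the latter, expand \<open>M\<close> and \<open>N\<close> in eigenbases with eigenvalues \<open>l\<^sub>i\<close> and \<open>m\<^sub>j\<close>, and let
  \<open>w\<^sub>j\<^sub>i\<close> be the squared moduli of the inner products of the eigenvectors. For each \<open>s > 0\<close> the sum
  \<open>\<Sum> w\<^sub>j\<^sub>i l\<^sub>i\<^sup>2 / (m\<^sub>j + s l\<^sub>i)\<close> is the maximum over all operators \<open>X\<close> of
  \<open>2 Re tr (X\<^sup>* M) - tr (N X X\<^sup>*) - s tr (M X\<^sup>* X)\<close>, and so decreases under a channel by the
  Kadison-Schwarz inequality for the dual channel. Integrating over \<open>s\<close> from \<open>0\<close> to \<open>\<infinity>\<close> gives
  the relative entropy, up to a term that depends on \<open>tr M\<close> only.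
\<close>

section \<open>Operators and positivity\<close>

lemma adj_adj [simp]: "adj (adj M) = M"
  by (simp add: adj_def vec_eq_iff)

lemma adj_mult: "adj (M ** N) = adj N ** adj M"
  by (simp add: adj_def matrix_matrix_mult_def vec_eq_iff mult.commute)

lemma adj_mat_1 [simp]: "adj (mat 1) = mat 1"
  by (auto simp: adj_def mat_def vec_eq_iff)

lemma adj_diff: "adj (M - N) = adj M - adj N"
  by (simp add: adj_def vec_eq_iff)

lemma adj_sum: "adj (\<Sum>i\<in>I. M i) = (\<Sum>i\<in>I. adj (M i))"
  by (simp add: adj_def vec_eq_iff)

lemma adj_ketbra: "adj (ketbra v w) = ketbra w v"
  by (simp add: adj_def ketbra_def vec_eq_iff)

lemma adj_tensor: "adj (M \<otimes>\<^sub>o N) = adj M \<otimes>\<^sub>o adj N"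
  by (simp add: adj_def tensor_def vec_eq_iff)

lemma sum_UNIV_prod:
  fixes f :: "'a::finite \<times> 'b::finite \<Rightarrow> 'c::comm_monoid_add"
  shows "(\<Sum>p\<in>UNIV. f p) = (\<Sum>a\<in>UNIV. \<Sum>b\<in>UNIV. f (a, b))"
  by (simp add: sum.cartesian_product UNIV_Times_UNIV[symmetric] del: UNIV_Times_UNIV)

lemma tensor_mult: "(A \<otimes>\<^sub>o B) ** (C \<otimes>\<^sub>o D) = (A ** C) \<otimes>\<^sub>o (B ** D)"
  by (simp add: tensor_def matrix_matrix_mult_def vec_eq_iff sum_UNIV_prod sum_product mult.assoc)
     (simp add: mult.left_commute)

lemma tensor_sum_left: "(\<Sum>i\<in>I. M i) \<otimes>\<^sub>o N = (\<Sum>i\<in>I. M i \<otimes>\<^sub>o N)"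
  by (simp add: tensor_def vec_eq_iff sum_distrib_right)

lemma tensor_mat_1: "mat 1 \<otimes>\<^sub>o mat 1 = mat 1"
  by (simp add: tensor_def mat_def vec_eq_iff prod_eq_iff)

lemma matrix_mult_sum_left:
  fixes M :: "'i \<Rightarrow> 'a::semiring_1 ^ 'n::finite ^ 'm::finite"
  shows "(\<Sum>i\<in>I. M i) ** N = (\<Sum>i\<in>I. M i ** N)"
  by (simp add: matrix_matrix_mult_def vec_eq_iff sum_distrib_right) (intro allI, rule sum.swap)

lemma matrix_mult_sum_right:
  fixes M :: "'i \<Rightarrow> 'a::semiring_1 ^ 'n::finite ^ 'm::finite"
  shows "N ** (\<Sum>i\<in>I. M i) = (\<Sum>i\<in>I. N ** M i)"
  by (simp add: matrix_matrix_mult_def vec_eq_iff sum_distrib_left) (intro allI, rule sum.swap)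

lemma matrix_mult_diff_left:
  fixes M :: "'a::ring_1 ^ 'n::finite ^ 'm::finite"
  shows "(M - M') ** N = M ** N - M' ** N"
  by (simp add: matrix_matrix_mult_def vec_eq_iff left_diff_distrib sum_subtractf)

lemma matrix_mult_diff_right:
  fixes M :: "'a::ring_1 ^ 'n::finite ^ 'm::finite"
  shows "M ** (N - N') = M ** N - M ** N'"
  by (simp add: matrix_matrix_mult_def vec_eq_iff right_diff_distrib sum_subtractf)

lemma matrix_vector_mult_sum_left:
  fixes M :: "'i \<Rightarrow> 'a::semiring_1 ^ 'n::finite ^ 'm::finite"
  shows "(\<Sum>i\<in>I. M i) *v v = (\<Sum>i\<in>I. M i *v v)"
  by (simp add: matrix_vector_mult_def vec_eq_iff sum_distrib_right) (intro allI, rule sum.swap)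

lemma trace_sum: "trace (\<Sum>i\<in>I. M i) = (\<Sum>i\<in>I. trace (M i))"
  by (simp add: trace_def) (rule sum.swap)

lemma cinner_adj: "cinner v (M *v w) = cinner (adj M *v v) w"
  by (simp add: cinner_def adj_def matrix_vector_mult_def sum_distrib_left sum_distrib_right mult_ac)
     (rule sum.swap)

lemma cnj_cinner: "cnj (cinner v w) = cinner w v"
  by (simp add: cinner_def mult.commute)

lemma cinner_self: "cinner v v = of_real ((norm v)\<^sup>2)"
  by (simp add: cinner_def norm_vec_def L2_set_def sum_nonneg complex_norm_square mult.commute
      del: of_real_power)

lemma cinner_diff_right: "cinner v (w - w') = cinner v w - cinner v w'"
  by (simp add: cinner_def right_diff_distrib sum_subtractf)

lemma cinner_diff_left: "cinner (v - v') w = cinner v w - cinner v' w"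
  by (simp add: cinner_def left_diff_distrib sum_subtractf)

lemma cinner_scale_right: "cinner v (c *s w) = c * cinner v w"
  by (simp add: cinner_def sum_distrib_left mult_ac)

lemma cinner_scale_left: "cinner (c *s v) w = cnj c * cinner v w"
  by (simp add: cinner_def sum_distrib_left mult_ac)

lemma cinner_add_right: "cinner v (w + w') = cinner v w + cinner v w'"
  by (simp add: cinner_def distrib_left sum.distrib)

lemma cinner_sum_right: "cinner v (\<Sum>i\<in>I. w i) = (\<Sum>i\<in>I. cinner v (w i))"
  by (simp add: cinner_def sum_distrib_left) (rule sum.swap)

lemma cinner_zero_right [simp]: "cinner v 0 = 0"
  by (simp add: cinner_def)

text \<open>Moving from \<open>v\<close> by \<open>- t *s (M *v v)\<close> changes the form by
  \<open>t * t * c - 2 * t * n\<close>, with \<open>n\<close> the squared norm of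
  \<open>M *v v\<close>; if \<open>n > 0\<close>, a small \<open>t\<close> would make the form
  negative. The invariant subspace \<open>W\<close> serves the inductive construction of
  eigenvectors.\<close>

lemma hermitian_form_kernel:
  assumes W: "vec.subspace W" "\<And>w. w \<in> W \<Longrightarrow> M *v w \<in> W"
    and M: "adj M = M" and nonneg: "\<And>w. w \<in> W \<Longrightarrow> 0 \<le> Re (cinner w (M *v w))"
    and v: "v \<in> W" "Re (cinner v (M *v v)) = 0"
  shows "M *v v = 0"
proof (rule ccontr)
  assume "M *v v \<noteq> 0"
  define w where "w = M *v v"
  define n where "n = (norm w)\<^sup>2"
  define c where "c = Re (cinner w (M *v w))"
  have n: "n > 0" using \<open>M *v v \<noteq> 0\<close> by (simp add: n_def w_def)
  have w: "w \<in> W" using W v by (simp add: w_def)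
  have c: "c \<ge> 0" using nonneg[OF w] by (simp add: c_def)
  \<comment> \<open>Any positive \<open>t\<close> with \<open>t * c < 2 * n\<close> would do; the
    \<open>1\<close> keeps the denominator positive.\<close>
  define t where "t = n / (c + 1)"
  have vw: "cinner v (M *v w) = of_real n"
    using cinner_adj[of v M w] M by (simp add: cinner_self n_def w_def)
  have wv: "cinner w (M *v v) = of_real n"
    by (simp add: cinner_self n_def w_def)
  have "v - of_real t *s w \<in> W"
    by (intro vec.subspace_diff vec.subspace_scale W v w)
  then have "0 \<le> Re (cinner (v - of_real t *s w) (M *v (v - of_real t *s w)))"
    by (rule nonneg)
  also have "M *v (v - of_real t *s w) = M *v v - of_real t *s (M *v w)"
    by (simp add: matrix_vector_mult_diff_distrib vec.scale)
  also have "Re (cinner (v - of_real t *s w) (M *v v - of_real t *s (M *v w)))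
      = t * t * c - 2 * t * n"
    using v by (simp add: cinner_diff_left cinner_diff_right cinner_scale_left cinner_scale_right
        vw wv c_def algebra_simps)
  also have "\<dots> = t * (n * c / (c + 1) - 2 * n)"
    by (simp add: t_def algebra_simps)
  finally have "0 \<le> t * (n * c / (c + 1) - 2 * n)" .
  moreover have "t > 0" using n c by (simp add: t_def)
  moreover have "n * c / (c + 1) \<le> n" using n c by (simp add: field_simps)
  ultimately show False using n by (simp add: zero_le_mult_iff)
qed

section \<open>Positive semidefinite operators\<close>

definition psd :: "'n::finite operator \<Rightarrow> bool" where
  "psd M \<longleftrightarrow> adj M = M \<and> (\<forall>v. 0 \<le> Re (cinner v (M *v v)))"

lemma density_operator_iff: "density_operator M \<longleftrightarrow> psd M \<and> trace M = 1"
  by (auto simp: density_operator_def psd_def)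

lemma psd_adj: "psd M \<Longrightarrow> adj M = M"
  by (simp add: psd_def)

lemma psd_form_nonneg: "psd M \<Longrightarrow> 0 \<le> Re (cinner v (M *v v))"
  by (simp add: psd_def)

lemma psd_kernel:
  assumes "psd M" "Re (cinner v (M *v v)) = 0"
  shows "M *v v = 0"
  using hermitian_form_kernel[of UNIV M v] assms by (simp add: psd_def vec.subspace_UNIV)

lemma cinner_conj: "cinner v ((K ** M ** adj K) *v w) = cinner (adj K *v v) (M *v (adj K *v w))"
  by (simp add: cinner_adj[of v K] matrix_vector_mul_assoc[symmetric])

lemma psd_conj:
  assumes "psd M"
  shows "psd (K ** M ** adj K)"
  using assms by (simp add: psd_def adj_mult cinner_conj matrix_mul_assoc)

lemma psd_sum:
  assumes "\<And>i. i \<in> I \<Longrightarrow> psd (M i)"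
  shows "psd (\<Sum>i\<in>I. M i)"
  using assms
  by (auto simp: psd_def adj_sum matrix_vector_mult_sum_left cinner_sum_right intro!: sum_nonneg)

lemma cinner_axis: "cinner (axis i 1) (M *v axis i 1) = M $ i $ i"
  by (simp add: cinner_def matrix_vector_mult_def)
    (simp add: axis_def if_distrib if_distribR cong: if_cong)

lemma trace_psd_nonneg:
  assumes "psd M"
  shows "0 \<le> Re (trace M)"
proof -
  have "0 \<le> Re (M $ i $ i)" for i
    using psd_form_nonneg[OF assms, of "axis i 1"] by (simp add: cinner_axis)
  then show ?thesis by (simp add: trace_def sum_nonneg)
qed

section \<open>The spectral theorem\<close>

definition diag_op :: "('n::finite \<Rightarrow> real) \<Rightarrow> 'n operator" where
  "diag_op d = (\<chi> i j. if i = j then of_real (d i) else 0)"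

lemma adj_diag_op [simp]: "adj (diag_op d) = diag_op d"
  by (auto simp: adj_def diag_op_def vec_eq_iff)

lemma diag_op_mult: "(diag_op d ** M) $ i $ j = of_real (d i) * M $ i $ j"
  by (simp add: diag_op_def matrix_matrix_mult_def if_distrib if_distribR cong: if_cong)

lemma mult_diag_op: "(M ** diag_op d) $ i $ j = M $ i $ j * of_real (d j)"
  by (simp add: diag_op_def matrix_matrix_mult_def if_distrib if_distribR cong: if_cong)

definition diagonalizes :: "'n::finite operator \<Rightarrow> ('n \<Rightarrow> real) \<Rightarrow> 'n operator \<Rightarrow> bool" where
  "diagonalizes U d M \<longleftrightarrow> unitary_op U \<and> M = U ** diag_op d ** adj U"

lemma unitary_opD:
  assumes "unitary_op U"
  shows "adj U ** U = mat 1" "U ** adj U = mat 1"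
  using assms by (simp_all add: unitary_op_def)

text \<open>A maximizer \<open>v\<close> of the form on the unit sphere of \<open>W\<close> is an
  eigenvector for the maximum \<open>l\<close>: the form of \<open>l - M\<close> is nonnegative on
  \<open>W\<close> and vanishes at \<open>v\<close>, so \<open>hermitian_form_kernel\<close>
  applies.\<close>

lemma hermitian_eigenvector:
  fixes M :: "'n::finite operator"
  assumes M: "adj M = M" and W: "vec.subspace W" "\<And>w. w \<in> W \<Longrightarrow> M *v w \<in> W"
    and x: "x \<in> W" "x \<noteq> 0"
  obtains v l where "v \<in> W" "norm v = 1" "M *v v = of_real l *s v"
proof -
  \<comment> \<open>Closedness is a fact about real subspaces, hence the passage from complex to
    real scalars.\<close>
  have scaleR: "c *\<^sub>R w = of_real c *s w" for c and w :: "complex ^ 'n"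
    by (simp only: vec_eq_iff vector_scaleR_component vector_smult_component)
      (simp add: scaleR_conv_of_real)
  have "subspace W"
    using W(1) unfolding vec.subspace_def subspace_def scaleR by blast
  then have "closed W" by (rule closed_subspace)
  then have "compact (sphere 0 1 \<inter> W)" by (simp add: compact_Int_closed)
  moreover have "(1 / norm x) *\<^sub>R x \<in> sphere 0 1 \<inter> W"
    using x \<open>subspace W\<close> by (simp add: subspace_scale)
  moreover have "continuous_on (sphere 0 1 \<inter> W) (\<lambda>w. Re (cinner w (M *v w)))"
    unfolding cinner_def matrix_vector_mult_def by (simp, intro continuous_intros)
  ultimately have "\<exists>v\<in>sphere 0 1 \<inter> W. \<forall>w\<in>sphere 0 1 \<inter> W.
      Re (cinner w (M *v w)) \<le> Re (cinner v (M *v v))"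
    by (intro continuous_attains_sup) blast+
  then obtain v where v: "v \<in> sphere 0 1 \<inter> W"
    and max: "\<And>w. w \<in> sphere 0 1 \<inter> W \<Longrightarrow> Re (cinner w (M *v w)) \<le> Re (cinner v (M *v v))"
    by blast
  define l where "l = Re (cinner v (M *v v))"
  define R where "R = diag_op (\<lambda>_. l) - M"
  have R: "R *v w = of_real l *s w - M *v w" for w
  proof -
    have "diag_op (\<lambda>_. l) *v w = of_real l *s w"
      by (simp add: vec_eq_iff diag_op_def matrix_vector_mult_def if_distrib if_distribR
          cong: if_cong)
    then show ?thesis by (simp add: R_def matrix_vector_mult_diff_rdistrib)
  qed
  have form: "Re (cinner w (R *v w)) = l * (norm w)\<^sup>2 - Re (cinner w (M *v w))" for w
    by (simp add: R cinner_diff_right cinner_scale_right cinner_self flip: of_real_power)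
  have "R *v v = 0"
  proof (rule hermitian_form_kernel)
    show "adj R = R" by (simp add: R_def adj_diff M)
    show "R *v w \<in> W" if "w \<in> W" for w
      using that W by (simp add: R vec.subspace_diff vec.subspace_scale)
    show "0 \<le> Re (cinner w (R *v w))" if "w \<in> W" for w
    proof (cases "w = 0")
      case False
      define u where "u = (1 / norm w) *\<^sub>R w"
      have "u \<in> sphere 0 1 \<inter> W"
        using False that \<open>subspace W\<close> by (simp add: u_def subspace_scale)
      then have "Re (cinner u (M *v u)) \<le> l" unfolding l_def by (rule max)
      moreover have "of_real (norm w) *s u = w"
        using False by (simp add: u_def flip: scaleR)
      moreover have "Re (cinner (of_real (norm w) *s u) (M *v (of_real (norm w) *s u)))
          = (norm w)\<^sup>2 * Re (cinner u (M *v u))"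
        by (simp add: vec.scale cinner_scale_left cinner_scale_right power2_eq_square)
      ultimately show ?thesis
        by (simp add: form mult.commute[of l] mult_left_mono)
    qed (simp add: form)
    show "Re (cinner v (R *v v)) = 0" using v by (simp add: form l_def)
  qed (use v W in auto)
  then show thesis using that[of v l] v by (simp add: R)
qed

text \<open>The orthogonal complement \<open>W\<close> of the eigenvectors found so far is invariant
  because \<open>M\<close> is Hermitian, and nonzero while there are fewer than
  \<open>CARD('n)\<close> of them; so it contains another one.\<close>

lemma hermitian_orthonormal_eigenvectors:
  fixes M :: "'n::finite operator"
  assumes M: "adj M = M" and "k \<le> CARD('n)"
  shows "\<exists>S. finite S \<and> card S = k \<and> (\<forall>u\<in>S. \<forall>v\<in>S. cinner u v = (if u = v then 1 else 0)) \<and>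
    (\<forall>u\<in>S. \<exists>l::real. M *v u = of_real l *s u)"
  using assms(2)
proof (induction k)
  case (Suc k)
  then obtain S where S: "finite S" "card S = k"
    and orth: "\<And>u v. u \<in> S \<Longrightarrow> v \<in> S \<Longrightarrow> cinner u v = (if u = v then 1 else 0)"
    and eig: "\<And>u. u \<in> S \<Longrightarrow> \<exists>l::real. M *v u = of_real l *s u"
    by auto
  define W where "W = {v. \<forall>u\<in>S. cinner u v = 0}"
  have sub: "vec.subspace W"
    by (auto simp: W_def vec.subspace_def cinner_add_right cinner_scale_right)
  have inv: "M *v w \<in> W" if w: "w \<in> W" for w
  proof -
    have "cinner u (M *v w) = 0" if u: "u \<in> S" for u
    proof -
      obtain l :: real where "M *v u = of_real l *s u" using eig[OF u] by blast
      then show ?thesis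
        using u w by (simp add: cinner_adj[of u M] M cinner_scale_left W_def)
    qed
    then show ?thesis by (simp add: W_def)
  qed
  have "\<not> UNIV \<subseteq> vec.span S"
  proof
    assume "UNIV \<subseteq> vec.span S"
    then have "vec.dim (UNIV :: (complex ^ 'n) set) \<le> card S"
      using S(1) by (rule vec.dim_le_card)
    then show False using S(2) Suc.prems by (simp add: card_cart_basis)
  qed
  then obtain y where y: "y \<notin> vec.span S" by blast
  \<comment> \<open>Removing from \<open>y\<close> its projection onto the span leaves a nonzero
    vector of \<open>W\<close>.\<close>
  define x where "x = y - (\<Sum>u\<in>S. cinner u y *s u)"
  have xW: "x \<in> W"
    using S(1) by (auto simp: W_def x_def cinner_diff_right cinner_sum_right cinner_scale_right
        orth if_distrib cong: if_cong)
  have "(\<Sum>u\<in>S. cinner u y *s u) \<in> vec.span S"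
    by (intro vec.span_sum vec.span_scale vec.span_base)
  then have "x \<noteq> 0" using y by (auto simp: x_def)
  with xW obtain v l where v: "v \<in> W" "norm v = 1" "M *v v = of_real l *s v"
    using hermitian_eigenvector[OF M sub inv] by blast
  have vv: "cinner v v = 1" using v(2) by (simp add: cinner_self)
  have uv: "cinner u v = 0" "cinner v u = 0" if "u \<in> S" for u
    using v(1) that cnj_cinner[of u v] by (auto simp: W_def)
  have "v \<notin> S" using uv vv by force
  then have "finite (insert v S)" "card (insert v S) = Suc k" using S by simp_all
  moreover have "\<forall>a\<in>insert v S. \<forall>b\<in>insert v S. cinner a b = (if a = b then 1 else 0)"
    using orth uv vv \<open>v \<notin> S\<close> by auto
  moreover have "\<forall>a\<in>insert v S. \<exists>l::real. M *v a = of_real l *s a"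
    using eig v(3) by blast
  ultimately show ?case by (intro exI[of _ "insert v S"] conjI)
qed (auto intro!: exI[of _ "{}"])

theorem hermitian_diagonalizes:
  fixes M :: "'n::finite operator"
  assumes "adj M = M"
  obtains U d where "diagonalizes U d M"
proof -
  obtain S where S: "finite S" "card S = CARD('n)"
    and orth: "\<And>u v. u \<in> S \<Longrightarrow> v \<in> S \<Longrightarrow> cinner u v = (if u = v then 1 else 0)"
    and eig: "\<And>u. u \<in> S \<Longrightarrow> \<exists>l::real. M *v u = of_real l *s u"
    using hermitian_orthonormal_eigenvectors[OF assms order_refl] by metis
  obtain g :: "'n \<Rightarrow> complex ^ 'n" where g: "bij_betw g UNIV S"
    using finite_same_card_bij[of "UNIV :: 'n set" S] S by auto
  then have gS: "g i \<in> S" for i by (auto simp: bij_betw_def)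
  have inj: "g i = g j \<longleftrightarrow> i = j" for i j using g by (auto simp: bij_betw_def inj_eq)
  have "\<forall>i. \<exists>l::real. M *v g i = of_real l *s g i" using eig gS by blast
  from choice[OF this] obtain d :: "'n \<Rightarrow> real"
    where d: "\<And>i. M *v g i = of_real (d i) *s g i" by blast
  define U where "U = (\<chi> i j. g j $ i)"
  have "adj U ** U = mat 1"
    using orth[OF gS gS] inj
    by (simp add: vec_eq_iff[of "adj U ** U"] vec_eq_iff[of "(adj U ** U) $ _"] U_def adj_def
        matrix_matrix_mult_def mat_def cinner_def)
  moreover from this have "U ** adj U = mat 1" using matrix_left_right_inverse by blast
  moreover have "M ** U = U ** diag_op d"
    using d by (simp add: vec_eq_iff mult_diag_op) (simp add: U_def matrix_matrix_mult_def
        matrix_vector_mult_def mult.commute)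
  then have "M ** (U ** adj U) = U ** diag_op d ** adj U"
    by (simp add: matrix_mul_assoc)
  ultimately show thesis
    using that[of U d] by (simp add: diagonalizes_def unitary_op_def)
qed

section \<open>Monotonicity of the relative entropy\<close>

lemma cnj_mult_self:
  "z * cnj z = (of_real (cmod z))\<^sup>2" "cnj z * z = (of_real (cmod z))\<^sup>2"
  using complex_norm_square[of z] by (simp_all add: mult.commute)

lemma unitary_cancel:
  assumes "unitary_op U"
  shows "M ** U ** adj U = M" "M ** adj U ** U = M"
  by (simp_all add: unitary_opD[OF assms] matrix_mul_assoc[symmetric])

lemma unitary_op_adj: "unitary_op U \<Longrightarrow> unitary_op (adj U)"
  by (simp add: unitary_op_def)

lemma unitary_op_mult:
  assumes "unitary_op U" "unitary_op V"
  shows "unitary_op (U ** V)"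
  using assms by (simp add: unitary_op_def adj_mult matrix_mul_assoc unitary_cancel)

lemma trace_conj_unitary:
  assumes "unitary_op U"
  shows "trace (U ** M ** adj U) = trace M"
  by (simp add: trace_mul_sym[of "U ** M"] matrix_mul_assoc unitary_opD[OF assms])

lemma diagonalizesD:
  assumes "diagonalizes U d M"
  shows "unitary_op U" "M = U ** diag_op d ** adj U"
  using assms by (simp_all add: diagonalizes_def)

lemma trace_diagonalizes:
  assumes "diagonalizes U d M"
  shows "trace M = of_real (\<Sum>i\<in>UNIV. d i)"
  by (simp add: diagonalizesD(2)[OF assms] trace_conj_unitary[OF diagonalizesD(1)[OF assms]])
    (simp add: trace_def diag_op_def)

lemma psd_diagonalizes_nonneg:
  assumes "diagonalizes U d M" "psd M"
  shows "0 \<le> d i"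
proof -
  have "adj U ** M ** adj (adj U) = diag_op d"
    using diagonalizesD[OF assms(1)]
    by (simp add: matrix_mul_assoc unitary_cancel unitary_opD)
  then have "psd (diag_op d)" using psd_conj[OF assms(2), of "adj U"] by simp
  from psd_form_nonneg[OF this, of "axis i 1"] show ?thesis
    by (simp add: cinner_axis) (simp add: diag_op_def)
qed

text \<open>The weights \<open>w\<close> of the introduction, with eigenvectors as columns of
  \<open>U\<close> and \<open>V\<close>. They form a doubly stochastic matrix when both are unitary,
  which collapses sums whose summand depends on one index only.\<close>

definition overlap :: "'n::finite operator \<Rightarrow> 'n operator \<Rightarrow> 'n \<Rightarrow> 'n \<Rightarrow> real" where
  "overlap U V j i = (cmod ((adj V ** U) $ j $ i))\<^sup>2"

lemma overlap_nonneg: "0 \<le> overlap U V j i"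
  by (simp add: overlap_def)

lemma sum_column_unitary:
  assumes "unitary_op C"
  shows "(\<Sum>j\<in>UNIV. (cmod (C $ j $ i))\<^sup>2) = 1"
proof -
  have "of_real (\<Sum>j\<in>UNIV. (cmod (C $ j $ i))\<^sup>2) = (adj C ** C) $ i $ i"
    by (simp add: matrix_matrix_mult_def adj_def complex_norm_square mult.commute
        del: of_real_power)
  also have "\<dots> = of_real 1" by (simp add: unitary_opD[OF assms] mat_def)
  finally show ?thesis by (simp only: of_real_eq_iff)
qed

lemma overlap_commute: "overlap U V j i = overlap V U i j"
proof -
  have "(adj V ** U) $ j $ i = cnj ((adj U ** V) $ i $ j)"
    by (simp add: adj_def matrix_matrix_mult_def mult.commute)
  then show ?thesis by (simp add: overlap_def)
qed

lemma sum_overlap_left: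
  assumes "unitary_op U" "unitary_op V"
  shows "(\<Sum>j\<in>UNIV. overlap U V j i) = 1"
  unfolding overlap_def by (intro sum_column_unitary unitary_op_mult unitary_op_adj assms)

lemma sum_overlap_right:
  assumes "unitary_op U" "unitary_op V"
  shows "(\<Sum>i\<in>UNIV. overlap U V j i) = 1"
  using sum_overlap_left[OF assms(2,1)] by (simp add: overlap_commute[of U])

lemma sum_overlap_fst:
  assumes "unitary_op U" "unitary_op V"
  shows "(\<Sum>j\<in>UNIV. \<Sum>i\<in>UNIV. overlap U V j i * f i) = (\<Sum>i\<in>UNIV. f i)"
  by (subst sum.swap) (simp add: sum_distrib_right[symmetric] sum_overlap_left[OF assms])

lemma sum_overlap_snd:
  assumes "unitary_op U" "unitary_op V"
  shows "(\<Sum>j\<in>UNIV. \<Sum>i\<in>UNIV. overlap U V j i * g j) = (\<Sum>j\<in>UNIV. g j)"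
  by (simp add: sum_distrib_right[symmetric] sum_overlap_right[OF assms])

lemma conj_diag_op_diagonal:
  "(adj C ** diag_op m ** C) $ i $ i = of_real (\<Sum>j\<in>UNIV. (cmod (C $ j $ i))\<^sup>2 * m j)"
proof -
  have *: "cnj z * of_real x * z = of_real ((cmod z)\<^sup>2 * x)" for z x
    by (simp add: complex_norm_square mult_ac del: of_real_power)
  have "(adj C ** diag_op m ** C) $ i $ i = (\<Sum>j\<in>UNIV. cnj (C $ j $ i) * of_real (m j) * C $ j $ i)"
    by (simp add: matrix_matrix_mult_def[of "adj C ** diag_op m"] mult_diag_op)
      (simp add: adj_def)
  then show ?thesis unfolding * by simp
qed

lemma diagonal_entry_in_eigenbasis:
  assumes "diagonalizes U l M"
  shows "(adj V ** M ** V) $ j $ j = of_real (\<Sum>i\<in>UNIV. overlap U V j i * l i)"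
proof -
  have "adj V ** M ** V = adj (adj U ** V) ** diag_op l ** (adj U ** V)"
    by (simp add: diagonalizesD(2)[OF assms] adj_mult matrix_mul_assoc)
  then show ?thesis
    by (simp add: conj_diag_op_diagonal overlap_commute[of U]) (simp add: overlap_def)
qed

text \<open>With the logarithms of the eigenvalues of \<open>N\<close> in place of \<open>m\<close>,
  this turns the cross term of the relative entropy into \<open>tr (M ln N)\<close>.\<close>

lemma trace_mult_diagonalized:
  assumes "diagonalizes U l M"
  shows "trace (M ** (V ** diag_op m ** adj V))
    = of_real (\<Sum>j\<in>UNIV. \<Sum>i\<in>UNIV. overlap U V j i * (l i * m j))"
proof -
  have "trace (M ** (V ** diag_op m ** adj V)) = trace (M ** V ** diag_op m ** adj V)"
    by (simp add: matrix_mul_assoc)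
  also have "\<dots> = trace ((adj V ** M ** V) ** diag_op m)"
    by (subst trace_mul_sym) (simp add: matrix_mul_assoc)
  also have "\<dots> = (\<Sum>j\<in>UNIV. (adj V ** M ** V) $ j $ j * of_real (m j))"
    by (simp add: trace_def mult_diag_op)
  also have "\<dots> = of_real (\<Sum>j\<in>UNIV. \<Sum>i\<in>UNIV. overlap U V j i * (l i * m j))"
    by (simp add: diagonal_entry_in_eigenbasis[OF assms] sum_distrib_right mult.assoc)
  finally show ?thesis .
qed

section \<open>Kernel inclusion and Kraus maps\<close>

text \<open>The zeros of the form of a positive operator are its kernel, so for such operators this
  is inclusion of kernels. The version with forms passes through Kraus sums term by term.\<close>

definition kernel_le :: "'n::finite operator \<Rightarrow> 'n operator \<Rightarrow> bool" where
  "kernel_le N M \<longleftrightarrow> (\<forall>v. Re (cinner v (N *v v)) = 0 \<longrightarrow> Re (cinner v (M *v v)) = 0)"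

text \<open>At the eigenvector \<open>v\<close> of \<open>N\<close> for the eigenvalue 0 the form of
  \<open>M\<close> vanishes; it is a sum of nonnegative terms \<open>overlap U V j i * l i\<close>.
  This disposes of the terms with \<open>ln 0\<close>.\<close>

lemma kernel_le_overlap:
  assumes M: "diagonalizes U l M" "psd M" and N: "diagonalizes V m N"
    and le: "kernel_le N M" and m: "m j = 0"
  shows "overlap U V j i * l i = 0"
proof -
  define v where "v = V *v axis j 1"
  have form: "cinner v (X *v v) = (adj V ** X ** V) $ j $ j" for X
    unfolding v_def using cinner_conj[of "axis j 1" "adj V" X "axis j 1"] by (simp add: cinner_axis)
  have "adj V ** N ** V = diag_op m"
    using diagonalizesD[OF N] by (simp add: matrix_mul_assoc unitary_cancel unitary_opD)
  then have "Re (cinner v (N *v v)) = 0" using m by (simp add: form) (simp add: diag_op_def)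
  then have "Re (cinner v (M *v v)) = 0" using le by (simp add: kernel_le_def)
  then have "(\<Sum>i\<in>UNIV. overlap U V j i * l i) = 0"
    by (simp add: form diagonal_entry_in_eigenbasis[OF M(1)])
  then show ?thesis
    by (simp add: sum_nonneg_eq_0_iff overlap_nonneg psd_diagonalizes_nonneg[OF M])
qed

definition kraus_map :: "'i set \<Rightarrow> ('i \<Rightarrow> 'n::finite operator) \<Rightarrow> 'n operator \<Rightarrow> 'n operator" where
  "kraus_map I K X = (\<Sum>i\<in>I. K i ** X ** adj (K i))"

lemma psd_kraus_map: "psd M \<Longrightarrow> psd (kraus_map I K M)"
  unfolding kraus_map_def by (intro psd_sum psd_conj)

lemma adj_kraus_map: "adj (kraus_map I K X) = kraus_map I K (adj X)"
  by (simp add: kraus_map_def adj_sum adj_mult matrix_mul_assoc)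

text \<open>By cyclicity of the trace, the Kraus operators \<open>adj (K i)\<close> give the dual
  map.\<close>

lemma trace_mult_kraus_map:
  "trace (A ** kraus_map I K X) = trace (kraus_map I (\<lambda>i. adj (K i)) A ** X)"
proof -
  have "trace (A ** (K i ** X ** adj (K i))) = trace (adj (K i) ** A ** K i ** X)" for i
    using trace_mul_sym[of "A ** K i ** X" "adj (K i)"] by (simp add: matrix_mul_assoc)
  then show ?thesis
    by (simp add: kraus_map_def matrix_mult_sum_left matrix_mult_sum_right trace_sum)
qed

lemma trace_kraus_map:
  assumes "(\<Sum>i\<in>I. adj (K i) ** K i) = mat 1"
  shows "trace (kraus_map I K X) = trace X"
  using trace_mult_kraus_map[of "mat 1" I K X] by (simp add: kraus_map_def assms)

lemma form_kraus_map:
  "cinner v (kraus_map I K M *v v) = (\<Sum>i\<in>I. cinner (adj (K i) *v v) (M *v (adj (K i) *v v)))"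
  by (simp add: kraus_map_def matrix_vector_mult_sum_left cinner_sum_right cinner_conj)

lemma kernel_le_kraus_map:
  assumes "finite I" "psd N" "kernel_le N M"
  shows "kernel_le (kraus_map I K N) (kraus_map I K M)"
  using assms
  by (simp add: kernel_le_def form_kraus_map sum_nonneg_eq_0_iff psd_form_nonneg)

text \<open>With \<open>D\<close> the dual map, the operator
  \<open>D (X ** adj X) - Z ** adj Z\<close> is the sum of the positive operators
  \<open>adj (W i) ** W i\<close>; this uses that the \<open>adj (K i) ** K i\<close> add up to the
  identity.\<close>

lemma trace_kadison_schwarz:
  fixes X :: "'n::finite operator"
  assumes K: "(\<Sum>i\<in>I. adj (K i) ** K i) = mat 1" and "psd M"
  defines "Z \<equiv> kraus_map I (\<lambda>i. adj (K i)) X"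
  shows "Re (trace (M ** Z ** adj Z)) \<le> Re (trace (M ** kraus_map I (\<lambda>i. adj (K i)) (X ** adj X)))"
proof -
  define W where "W i = adj X ** K i - K i ** adj Z" for i
  define a b c d where "a i = adj (K i) ** X ** K i" and "b i = adj (K i) ** adj X ** K i"
    and "c i = adj (K i) ** K i" and "d i = adj (K i) ** (X ** adj X) ** K i" for i
  have sums: "(\<Sum>i\<in>I. a i) = Z" "(\<Sum>i\<in>I. b i) = adj Z" "(\<Sum>i\<in>I. c i) = mat 1"
      "(\<Sum>i\<in>I. d i) = kraus_map I (\<lambda>i. adj (K i)) (X ** adj X)"
    by (simp_all add: a_def b_def c_def d_def Z_def adj_kraus_map K) (simp_all add: kraus_map_def)
  have "adj (W i) ** W i = d i - a i ** adj Z - (Z ** b i - Z ** c i ** adj Z)" for i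
    by (simp add: a_def b_def c_def d_def W_def adj_diff adj_mult matrix_mult_diff_left
        matrix_mult_diff_right matrix_mul_assoc)
  then have "(\<Sum>i\<in>I. adj (W i) ** W i) =
      kraus_map I (\<lambda>i. adj (K i)) (X ** adj X) - Z ** adj Z - (Z ** adj Z - Z ** adj Z)"
    by (simp add: sum_subtractf sums flip: matrix_mult_sum_left matrix_mult_sum_right)
  then have "Re (trace (M ** kraus_map I (\<lambda>i. adj (K i)) (X ** adj X))) - Re (trace (M ** Z ** adj Z))
      = (\<Sum>i\<in>I. Re (trace (M ** (adj (W i) ** W i))))"
    by (simp add: trace_sum[symmetric] matrix_mult_sum_right[symmetric] Re_sum[symmetric] del: Re_sum)
      (simp add: matrix_mult_diff_right trace_sub matrix_mul_assoc)
  also have "\<dots> \<ge> 0"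
  proof (rule sum_nonneg)
    fix i
    have "trace (M ** (adj (W i) ** W i)) = trace (W i ** M ** adj (W i))"
      using trace_mul_sym[of "M ** adj (W i)" "W i"] by (simp add: matrix_mul_assoc)
    then show "0 \<le> Re (trace (M ** (adj (W i) ** W i)))"
      using trace_psd_nonneg[OF psd_conj[OF \<open>psd M\<close>]] by simp
  qed
  finally show ?thesis by simp
qed

section \<open>A variational formula for the resolvent form\<close>

definition variational_form ::
    "real \<Rightarrow> 'n::finite operator \<Rightarrow> 'n operator \<Rightarrow> 'n operator \<Rightarrow> real" where
  "variational_form s M N X =
     2 * Re (trace (adj X ** M)) - Re (trace (N ** X ** adj X)) - s * Re (trace (M ** adj X ** X))"

text \<open>Duality carries the linear term over unchanged. The two subtracted quadratic terms can
  only shrink, by \<open>trace_kadison_schwarz\<close> for \<open>X\<close> and for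
  \<open>adj X\<close>.\<close>

lemma variational_form_kraus_map:
  assumes K: "(\<Sum>i\<in>I. adj (K i) ** K i) = mat 1" and "psd M" "psd N" "0 \<le> s"
  shows "variational_form s (kraus_map I K M) (kraus_map I K N) X
    \<le> variational_form s M N (kraus_map I (\<lambda>i. adj (K i)) X)"
proof -
  let ?D = "kraus_map I (\<lambda>i. adj (K i))"
  have dual: "trace (kraus_map I K A ** B) = trace (A ** ?D B)" for A B
    by (metis trace_mul_sym trace_mult_kraus_map)
  have "trace (adj X ** kraus_map I K M) = trace (adj (?D X) ** M)"
    by (simp add: trace_mult_kraus_map adj_kraus_map)
  moreover have "Re (trace (N ** ?D X ** adj (?D X))) \<le> Re (trace (kraus_map I K N ** X ** adj X))"
    using trace_kadison_schwarz[OF K \<open>psd N\<close>, of X]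
    by (simp add: dual matrix_mul_assoc[symmetric])
  moreover have "Re (trace (M ** adj (?D X) ** ?D X)) \<le> Re (trace (kraus_map I K M ** adj X ** X))"
    using trace_kadison_schwarz[OF K \<open>psd M\<close>, of "adj X"]
    by (simp add: dual matrix_mul_assoc[symmetric] adj_kraus_map)
  ultimately show ?thesis
    using \<open>0 \<le> s\<close> by (simp add: variational_form_def add_mono diff_mono mult_left_mono)
qed

text \<open>For positive \<open>M\<close>, \<open>N\<close> and \<open>s > 0\<close> this is
  \<open>tr (M X)\<close> for any solution \<open>X\<close> of \<open>N X + s X M = M\<close>,
  written in eigenbases. A denominator then vanishes only where \<open>l i = 0\<close>, and the
  quotient is 0 there.\<close>

definition resolvent_form ::
    "'n::finite operator \<Rightarrow> ('n \<Rightarrow> real) \<Rightarrow> 'n operator \<Rightarrow> ('n \<Rightarrow> real) \<Rightarrow> real \<Rightarrow> real" where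
  "resolvent_form U l V m s =
     (\<Sum>j\<in>UNIV. \<Sum>i\<in>UNIV. overlap U V j i * ((l i)\<^sup>2 / (m j + s * l i)))"

text \<open>In the coordinates \<open>Y\<close>, left multiplication by \<open>N\<close> and right
  multiplication by \<open>M\<close> are both diagonal, so the form splits into one scalar quadratic
  for each entry.\<close>

lemma variational_form_coordinates:
  assumes M: "diagonalizes U l M" and N: "diagonalizes V m N"
  shows "variational_form s M N (V ** Y ** adj U) =
    (\<Sum>j\<in>UNIV. \<Sum>i\<in>UNIV. 2 * (Re (cnj (Y $ j $ i) * (adj V ** U) $ j $ i) * l i)
       - (m j + s * l i) * (cmod (Y $ j $ i))\<^sup>2)"
proof -
  let ?X = "V ** Y ** adj U" and ?C = "adj V ** U"
  note U = diagonalizesD(1)[OF M] and V = diagonalizesD(1)[OF N]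
  have "adj ?X ** M = U ** (adj Y ** ?C ** diag_op l) ** adj U"
    by (simp add: diagonalizesD(2)[OF M] adj_mult matrix_mul_assoc)
  then have "trace (adj ?X ** M) = trace (adj Y ** ?C ** diag_op l)"
    by (simp add: trace_conj_unitary[OF U])
  also have "\<dots> = (\<Sum>i\<in>UNIV. \<Sum>j\<in>UNIV. cnj (Y $ j $ i) * ?C $ j $ i * of_real (l i))"
    by (simp add: trace_def mult_diag_op matrix_matrix_mult_def[of "adj Y"] sum_distrib_right)
      (simp add: adj_def)
  finally have 1: "trace (adj ?X ** M) =
      (\<Sum>j\<in>UNIV. \<Sum>i\<in>UNIV. cnj (Y $ j $ i) * ?C $ j $ i * of_real (l i))"
    by (subst sum.swap)
  have "N ** ?X ** adj ?X = V ** (diag_op m ** (Y ** adj Y)) ** adj V"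
    by (simp add: diagonalizesD(2)[OF N] adj_mult matrix_mul_assoc unitary_cancel[OF U]
        unitary_cancel[OF V])
  then have "trace (N ** ?X ** adj ?X) = trace (diag_op m ** (Y ** adj Y))"
    by (simp add: trace_conj_unitary[OF V])
  also have "\<dots> = of_real (\<Sum>j\<in>UNIV. \<Sum>i\<in>UNIV. m j * (cmod (Y $ j $ i))\<^sup>2)"
    by (simp add: trace_def diag_op_mult matrix_matrix_mult_def[of "Y"] sum_distrib_left)
      (simp add: adj_def cnj_mult_self)
  finally have 2: "trace (N ** ?X ** adj ?X) = of_real (\<Sum>j\<in>UNIV. \<Sum>i\<in>UNIV. m j * (cmod (Y $ j $ i))\<^sup>2)" .
  have "M ** adj ?X ** ?X = U ** (diag_op l ** (adj Y ** Y)) ** adj U"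
    by (simp add: diagonalizesD(2)[OF M] adj_mult matrix_mul_assoc unitary_cancel[OF U]
        unitary_cancel[OF V])
  then have "trace (M ** adj ?X ** ?X) = trace (diag_op l ** (adj Y ** Y))"
    by (simp add: trace_conj_unitary[OF U])
  also have "\<dots> = of_real (\<Sum>i\<in>UNIV. \<Sum>j\<in>UNIV. l i * (cmod (Y $ j $ i))\<^sup>2)"
    by (simp add: trace_def diag_op_mult matrix_matrix_mult_def[of "adj Y"] sum_distrib_left)
      (simp add: adj_def cnj_mult_self)
  finally have 3: "trace (M ** adj ?X ** ?X) = of_real (\<Sum>j\<in>UNIV. \<Sum>i\<in>UNIV. l i * (cmod (Y $ j $ i))\<^sup>2)"
    by (subst sum.swap)
  show ?thesis
    unfolding variational_form_def 1 2 3
    by (simp add: sum_subtractf sum.distrib sum_distrib_left algebra_simps)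
qed

text \<open>With \<open>a = m + s * l > 0\<close>, the right side exceeds the left by
  \<open>|a y - l c|^2 / a\<close>, so the maximum over \<open>y\<close> is attained at
  \<open>y = l c / a\<close>.\<close>

lemma complete_square_bound:
  fixes y c :: complex
  assumes "0 \<le> m" "0 \<le> l" "0 < s"
  shows "2 * (Re (cnj y * c) * l) - (m + s * l) * (cmod y)\<^sup>2 \<le> (cmod c)\<^sup>2 * (l\<^sup>2 / (m + s * l))"
proof (cases "l = 0")
  case False
  define a where "a = m + s * l"
  have a: "a > 0" using assms False by (simp add: a_def add_nonneg_pos)
  have "0 \<le> (cmod (of_real a * y - of_real l * c))\<^sup>2" by simp
  also have "\<dots> = a * (a * (cmod y)\<^sup>2 - 2 * (Re (cnj y * c) * l)) + (cmod c)\<^sup>2 * l\<^sup>2"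
    unfolding cmod_power2 by (simp add: power2_eq_square algebra_simps)
  finally show ?thesis using a unfolding a_def[symmetric] by (simp add: field_simps)
qed (use assms in simp)

text \<open>Take an optimal operator for the image pair, pull it back along the dual channel, and
  bound its value there by the maximum for the original pair.\<close>

lemma resolvent_form_kraus_map_le:
  assumes K: "(\<Sum>i\<in>I. adj (K i) ** K i) = mat 1" and psd: "psd M" "psd N" and s: "0 < s"
    and M: "diagonalizes U l M" and N: "diagonalizes V m N"
    and M': "diagonalizes U' l' (kraus_map I K M)" and N': "diagonalizes V' m' (kraus_map I K N)"
  shows "resolvent_form U' l' V' m' s \<le> resolvent_form U l V m s"
proof -
  define C where "C = adj V' ** U'"
  \<comment> \<open>The maximizer from \<open>complete_square_bound\<close> in every entry; where
    the denominator is 0, the entry is 0.\<close>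
  define Y :: "'a operator" where "Y = (\<chi> j i. of_real (l' i / (m' j + s * l' i)) * C $ j $ i)"
  have "2 * (Re (cnj (of_real (x / a) * c) * c) * x) - a * (cmod (of_real (x / a) * c))\<^sup>2
      = (cmod c)\<^sup>2 * (x\<^sup>2 / a)" for c x a
    unfolding cmod_power2 by (cases "a = 0") (simp_all add: power2_eq_square field_simps)
  then have "resolvent_form U' l' V' m' s
      = variational_form s (kraus_map I K M) (kraus_map I K N) (V' ** Y ** adj U')"
    by (simp add: resolvent_form_def variational_form_coordinates[OF M' N'] overlap_def
        Y_def C_def del: of_real_divide)
  also have "\<dots> \<le> variational_form s M N (kraus_map I (\<lambda>i. adj (K i)) (V' ** Y ** adj U'))"
    using s by (intro variational_form_kraus_map K psd) simp
  also have "\<dots> \<le> resolvent_form U l V m s"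
  proof -
    define X where "X = kraus_map I (\<lambda>i. adj (K i)) (V' ** Y ** adj U')"
    \<comment> \<open>Every operator has coordinates with respect to the two eigenbases, so the
      entrywise bound covers \<open>X\<close>.\<close>
    have "X = V ** (adj V ** X ** U) ** adj U"
      by (simp add: matrix_mul_assoc unitary_cancel diagonalizesD(1)[OF M] unitary_opD
          diagonalizesD(1)[OF N])
    then have "variational_form s M N X = variational_form s M N (V ** (adj V ** X ** U) ** adj U)"
      by simp
    also have "\<dots> \<le> resolvent_form U l V m s"
      unfolding variational_form_coordinates[OF M N] resolvent_form_def overlap_def
      by (intro sum_mono complete_square_bound s psd_diagonalizes_nonneg[OF M psd(1)]
          psd_diagonalizes_nonneg[OF N psd(2)])
    finally show ?thesis by (simp add: X_def)
  qed
  finally show ?thesis .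
qed

text \<open>An antiderivative of \<^const>\<open>resolvent_form\<close> in \<open>s\<close>: at \<open>0\<close> it is \<open>tr (M ln N)\<close>, and at infinity it
  is asymptotic to \<open>tr M ln s + tr (M ln M)\<close>.\<close>

definition log_potential ::
    "'n::finite operator \<Rightarrow> ('n \<Rightarrow> real) \<Rightarrow> 'n operator \<Rightarrow> ('n \<Rightarrow> real) \<Rightarrow> real \<Rightarrow> real" where
  "log_potential U l V m s =
     (\<Sum>j\<in>UNIV. \<Sum>i\<in>UNIV. overlap U V j i * (l i * ln (m j + s * l i)))"

section \<open>Integration over \<open>s\<close>\<close>

lemma log_potential_deriv:
  assumes "\<And>i. 0 \<le> l i" "\<And>j. 0 \<le> m j" "0 < s"
  shows "(log_potential U l V m has_real_derivative resolvent_form U l V m s) (at s)"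
proof -
  have "((\<lambda>s. l i * ln (m j + s * l i)) has_real_derivative (l i)\<^sup>2 / (m j + s * l i)) (at s)" for i j
  proof (cases "l i = 0")
    case False
    then have "l i > 0" using assms(1)[of i] by simp
    then have "m j + s * l i > 0" using assms(2)[of j] assms(3) by (simp add: add_nonneg_pos)
    then show ?thesis
      by (auto intro!: derivative_eq_intros simp: power2_eq_square field_simps)
  qed simp
  then show ?thesis
    unfolding log_potential_def[abs_def] resolvent_form_def by (intro DERIV_sum DERIV_cmult)
qed

text \<open>Since \<open>ln (m + T l) - ln T = ln (m / T + l)\<close> for large \<open>T\<close> and
  \<open>l > 0\<close>, each term converges once \<open>ln T\<close> is subtracted; the overlaps sum
  to 1 over \<open>j\<close>, so the subtractions total \<open>ln T\<close> times the sum of the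
  \<open>l i\<close>.\<close>

lemma log_potential_at_top:
  assumes U: "unitary_op U" "unitary_op V" and nonneg: "\<And>i. 0 \<le> l i"
  shows "((\<lambda>T. log_potential U l V m T - ln T * (\<Sum>i\<in>UNIV. l i)) \<longlongrightarrow> (\<Sum>i\<in>UNIV. l i * ln (l i))) at_top"
proof -
  have lim: "((\<lambda>T. l i * (ln (m j + T * l i) - ln T)) \<longlongrightarrow> l i * ln (l i)) at_top" for i j
  proof (cases "l i = 0")
    case False
    then have pos: "l i > 0" using nonneg[of i] by simp
    have "((\<lambda>T. m j / T + l i) \<longlongrightarrow> 0 + l i) at_top"
      by (intro tendsto_add tendsto_const tendsto_divide_0[OF tendsto_const]
          filterlim_at_top_imp_at_infinity filterlim_ident)
    then have "((\<lambda>T. ln (m j / T + l i)) \<longlongrightarrow> ln (l i)) at_top"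
      using pos by (intro tendsto_ln) simp_all
    moreover have "\<forall>\<^sub>F T in at_top. ln (m j / T + l i) = ln (m j + T * l i) - ln T"
    proof -
      have "((\<lambda>T. m j / T + l i) \<longlongrightarrow> l i) at_top"
        using \<open>((\<lambda>T. m j / T + l i) \<longlongrightarrow> 0 + l i) at_top\<close> by simp
      then have "\<forall>\<^sub>F T in at_top. 0 < m j / T + l i" using pos by (rule order_tendstoD)
      then show ?thesis using eventually_gt_at_top[of 0]
      proof eventually_elim
        case (elim T)
        then have "m j + T * l i = T * (m j / T + l i)" by (simp add: field_simps)
        then show ?case using elim by (simp only: ln_mult_pos)
      qed
    qed
    ultimately have "((\<lambda>T. ln (m j + T * l i) - ln T) \<longlongrightarrow> ln (l i)) at_top"
      by (rule Lim_transform_eventually)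
    then show ?thesis by (rule tendsto_mult_left)
  qed simp
  have "log_potential U l V m T - ln T * (\<Sum>i\<in>UNIV. l i) =
      (\<Sum>j\<in>UNIV. \<Sum>i\<in>UNIV. overlap U V j i * (l i * (ln (m j + T * l i) - ln T)))" for T
    unfolding log_potential_def sum_distrib_left sum_overlap_fst[OF U, of "\<lambda>i. ln T * l i", symmetric]
    by (simp add: sum_subtractf algebra_simps)
  moreover have "((\<lambda>T. \<Sum>j\<in>UNIV. \<Sum>i\<in>UNIV. overlap U V j i * (l i * (ln (m j + T * l i) - ln T)))
      \<longlongrightarrow> (\<Sum>j\<in>UNIV. \<Sum>i\<in>UNIV. overlap U V j i * (l i * ln (l i)))) at_top"
    by (intro tendsto_sum tendsto_mult_left lim)
  ultimately show ?thesis by (simp add: sum_overlap_fst[OF U])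
qed

text \<open>Only terms with \<open>m j = 0\<close> could diverge, like \<open>ln s\<close>, and
  their coefficients are 0 by \<open>kernel\<close>.\<close>

lemma log_potential_at_right_0:
  assumes nonneg: "\<And>j. 0 \<le> m j" and kernel: "\<And>i j. m j = 0 \<Longrightarrow> overlap U V j i * l i = 0"
  shows "(log_potential U l V m \<longlongrightarrow> (\<Sum>j\<in>UNIV. \<Sum>i\<in>UNIV. overlap U V j i * (l i * ln (m j)))) (at_right 0)"
proof -
  have "((\<lambda>s. overlap U V j i * (l i * ln (m j + s * l i))) \<longlongrightarrow> overlap U V j i * (l i * ln (m j)))
      (at_right 0)" for i j
  proof (cases "m j = 0")
    case True
    then show ?thesis using kernel[of j i] by auto
  next
    case False
    have "((\<lambda>s. m j + s * l i) \<longlongrightarrow> m j + 0 * l i) (at_right 0)"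
      by (intro tendsto_intros)
    then show ?thesis
      using False by (intro tendsto_mult_left tendsto_ln) simp_all
  qed
  then show ?thesis unfolding log_potential_def[abs_def] by (intro tendsto_sum)
qed

text \<open>Since \<open>ln 0 = 0\<close> here, this is the relative entropy of \<open>M\<close> and \<open>N\<close> only if the kernel of \<open>N\<close>
  is contained in that of \<open>M\<close>; otherwise the latter is infinite.\<close>

definition relative_entropy ::
    "'n::finite operator \<Rightarrow> ('n \<Rightarrow> real) \<Rightarrow> 'n operator \<Rightarrow> ('n \<Rightarrow> real) \<Rightarrow> real" where
  "relative_entropy U l V m =
     (\<Sum>i\<in>UNIV. l i * ln (l i)) - (\<Sum>j\<in>UNIV. \<Sum>i\<in>UNIV. overlap U V j i * (l i * ln (m j)))"

text \<open>The difference \<open>?G - ?G'\<close> has the nonnegative difference of the resolvent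
  forms as derivative. So its limit at infinity, \<open>?A - ?A'\<close>, is at least its limit at
  0, the difference of the cross terms.\<close>

theorem relative_entropy_kraus_map_le:
  assumes I: "finite I" and K: "(\<Sum>i\<in>I. adj (K i) ** K i) = mat 1"
    and psd: "psd M" "psd N" and le: "kernel_le N M"
    and M: "diagonalizes U l M" and N: "diagonalizes V m N"
    and M': "diagonalizes U' l' (kraus_map I K M)" and N': "diagonalizes V' m' (kraus_map I K N)"
  shows "relative_entropy U' l' V' m' \<le> relative_entropy U l V m"
proof -
  note psd' = psd[THEN psd_kraus_map, of I K]
  note nonneg = psd_diagonalizes_nonneg[OF M psd(1)] psd_diagonalizes_nonneg[OF N psd(2)]
  note nonneg' = psd_diagonalizes_nonneg[OF M' psd'(1)] psd_diagonalizes_nonneg[OF N' psd'(2)]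
  let ?G = "log_potential U l V m" and ?G' = "log_potential U' l' V' m'"
  let ?A = "\<Sum>i\<in>UNIV. l i * ln (l i)" and ?A' = "\<Sum>i\<in>UNIV. l' i * ln (l' i)"
  have "of_real (\<Sum>i\<in>UNIV. l' i) = (of_real (\<Sum>i\<in>UNIV. l i) :: complex)"
    using trace_kraus_map[OF K, of M] by (simp only: trace_diagonalizes[OF M] trace_diagonalizes[OF M'])
  then have tr: "(\<Sum>i\<in>UNIV. l' i) = (\<Sum>i\<in>UNIV. l i)" by (simp only: of_real_eq_iff)
  have mono: "?G' T - ?G' s \<le> ?G T - ?G s" if "0 < s" "s \<le> T" for s T
  proof -
    have "?G s - ?G' s \<le> ?G T - ?G' T"
    proof (rule DERIV_nonneg_imp_nondecreasing[OF \<open>s \<le> T\<close>])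
      fix x assume "s \<le> x"
      then have "0 < x" using \<open>0 < s\<close> by simp
      then show "\<exists>y. ((\<lambda>s. ?G s - ?G' s) has_real_derivative y) (at x) \<and> 0 \<le> y"
        using resolvent_form_kraus_map_le[OF K psd \<open>0 < x\<close> M N M' N']
        by (intro exI[of _ "resolvent_form U l V m x - resolvent_form U' l' V' m' x"] conjI
            DERIV_diff log_potential_deriv nonneg nonneg') simp_all
    qed
    then show ?thesis by simp
  qed
  \<comment> \<open>Let \<open>T\<close> tend to infinity; by \<open>tr\<close> the same divergent
    term \<open>?c\<close> is subtracted on both sides.\<close>
  have half: "?A' - ?G' s \<le> ?A - ?G s" if "0 < s" for s
  proof (rule tendsto_le)
    let ?c = "\<lambda>T. ln T * (\<Sum>i\<in>UNIV. l i)"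
    show "((\<lambda>T. ?G T - ?c T - ?G s) \<longlongrightarrow> ?A - ?G s) at_top"
      by (intro tendsto_diff tendsto_const log_potential_at_top nonneg diagonalizesD[OF M] diagonalizesD[OF N])
    show "((\<lambda>T. ?G' T - ?c T - ?G' s) \<longlongrightarrow> ?A' - ?G' s) at_top"
      unfolding tr[symmetric]
      by (intro tendsto_diff tendsto_const log_potential_at_top nonneg' diagonalizesD[OF M'] diagonalizesD[OF N'])
    show "\<forall>\<^sub>F T in at_top. ?G' T - ?c T - ?G' s \<le> ?G T - ?c T - ?G s"
      using eventually_ge_at_top[of s] by eventually_elim (use mono[OF that] in force)
  qed simp
  \<comment> \<open>Let \<open>s\<close> tend to 0; the kernel inclusion holds for the image pair as
    well.\<close>
  show ?thesis
    unfolding relative_entropy_def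
  proof (rule tendsto_le)
    show "((\<lambda>s. ?A - ?G s) \<longlongrightarrow>
        ?A - (\<Sum>j\<in>UNIV. \<Sum>i\<in>UNIV. overlap U V j i * (l i * ln (m j)))) (at_right 0)"
      by (intro tendsto_diff tendsto_const log_potential_at_right_0 nonneg
          kernel_le_overlap[OF M psd(1) N le])
    show "((\<lambda>s. ?A' - ?G' s) \<longlongrightarrow>
        ?A' - (\<Sum>j\<in>UNIV. \<Sum>i\<in>UNIV. overlap U' V' j i * (l' i * ln (m' j)))) (at_right 0)"
      by (intro tendsto_diff tendsto_const log_potential_at_right_0 nonneg'
          kernel_le_overlap[OF M' psd'(1) N' kernel_le_kraus_map[OF I psd(2) le]])
    show "\<forall>\<^sub>F s in at_right 0. ?A' - ?G' s \<le> ?A - ?G s"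
      using half by (auto simp: eventually_at_right_field intro!: exI[of _ 1])
  qed simp
qed

text \<open>Klein's inequality: \<open>ln x <= x - 1\<close> at \<open>x = m j / l i\<close> bounds
  each \<open>l i - m j\<close>, and the weighted sum of these is 0 because the traces
  agree.\<close>

theorem relative_entropy_nonneg:
  assumes psd: "psd M" "psd N" and le: "kernel_le N M" and tr: "trace M = trace N"
    and M: "diagonalizes U l M" and N: "diagonalizes V m N"
  shows "0 \<le> relative_entropy U l V m"
proof -
  note nonneg = psd_diagonalizes_nonneg[OF M psd(1)] psd_diagonalizes_nonneg[OF N psd(2)]
  note unitary = diagonalizesD(1)[OF M] diagonalizesD(1)[OF N]
  have "of_real (\<Sum>i\<in>UNIV. l i) = (of_real (\<Sum>i\<in>UNIV. m i) :: complex)"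
    using tr by (simp only: trace_diagonalizes[OF M] trace_diagonalizes[OF N])
  then have "(\<Sum>i\<in>UNIV. l i) = (\<Sum>j\<in>UNIV. m j)" by (simp only: of_real_eq_iff)
  then have "0 = (\<Sum>j\<in>UNIV. \<Sum>i\<in>UNIV. overlap U V j i * (l i - m j))"
    by (simp add: right_diff_distrib sum_subtractf sum_overlap_fst[OF unitary] sum_overlap_snd[OF unitary])
  also have "\<dots> \<le> (\<Sum>j\<in>UNIV. \<Sum>i\<in>UNIV. overlap U V j i * (l i * (ln (l i) - ln (m j))))"
  proof (intro sum_mono)
    fix j i
    show "overlap U V j i * (l i - m j) \<le> overlap U V j i * (l i * (ln (l i) - ln (m j)))"
    \<comment> \<open>Here \<open>ln 0 = 0\<close> matters: for \<open>l i = 0\<close> the right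
      side is 0 and the left at most 0; for \<open>m j = 0\<close> both vanish by the kernel
      inclusion.\<close>
    proof (cases "l i = 0 \<or> m j = 0")
      case True
      then show ?thesis
        using kernel_le_overlap[OF M psd(1) N le, of j i] nonneg(2)[of j] overlap_nonneg[of U V j i]
        by auto
    next
      case False
      then have pos: "l i > 0" "m j > 0" using nonneg(1)[of i] nonneg(2)[of j] by simp_all
      then have "ln (m j / l i) \<le> m j / l i - 1" by (intro ln_le_minus_one) simp
      then have "l i * (ln (m j) - ln (l i)) \<le> l i * (m j / l i - 1)"
        using pos by (intro mult_left_mono) (simp_all add: ln_div)
      then have "l i - m j \<le> l i * (ln (l i) - ln (m j))"
        using pos by (simp add: algebra_simps)
      then show ?thesis by (intro mult_left_mono overlap_nonneg)
    qed
  qed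
  also have "\<dots> = relative_entropy U l V m"
    unfolding relative_entropy_def sum_overlap_fst[OF unitary, of "\<lambda>i. l i * ln (l i)", symmetric]
    by (simp add: sum_subtractf right_diff_distrib)
  finally show ?thesis .
qed

text \<open>In this form a pinching can be moved across the trace in the cross term.\<close>

lemma relative_entropy_trace:
  assumes "diagonalizes U l M"
  shows "relative_entropy U l V m =
    (\<Sum>i\<in>UNIV. l i * ln (l i)) - Re (trace (M ** (V ** diag_op (\<lambda>j. ln (m j)) ** adj V)))"
  by (simp add: relative_entropy_def trace_mult_diagonalized[OF assms])

section \<open>Entropy and pinching\<close>

lemma eigenspace_diagonalizes:
  assumes "diagonalizes U d M"
  shows "eigenspace M (of_real x) = (*v) U ` {w. \<forall>i. i \<notin> {i. d i = x} \<longrightarrow> w $ i = 0}"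
proof -
  note U = diagonalizesD(1)[OF assms]
  have inv: "U *v (adj U *v v) = v" "adj U *v (U *v v) = v" for v
    by (simp_all add: matrix_vector_mul_assoc unitary_opD[OF U])
  have eq: "M *v (U *v w) = of_real x *s (U *v w) \<longleftrightarrow> (\<forall>i. i \<notin> {i. d i = x} \<longrightarrow> w $ i = 0)" for w
  proof -
    have "M *v (U *v w) = U *v (diag_op d *v w)"
      by (simp add: diagonalizesD(2)[OF assms] matrix_vector_mul_assoc unitary_cancel[OF U])
    then have "M *v (U *v w) = of_real x *s (U *v w) \<longleftrightarrow> U *v (diag_op d *v w) = U *v (of_real x *s w)"
      by (simp add: vec.scale)
    also have "\<dots> \<longleftrightarrow> diag_op d *v w = of_real x *s w" using inv(2) by metis
    also have "\<dots> \<longleftrightarrow> (\<forall>i. i \<notin> {i. d i = x} \<longrightarrow> w $ i = 0)"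
      by (auto simp: vec_eq_iff diag_op_def matrix_vector_mult_def if_distrib if_distribR cong: if_cong)
    finally show ?thesis .
  qed
  show ?thesis
  proof (intro set_eqI iffI)
    fix v assume "v \<in> eigenspace M (of_real x)"
    then show "v \<in> (*v) U ` {w. \<forall>i. i \<notin> {i. d i = x} \<longrightarrow> w $ i = 0}"
      using eq[of "adj U *v v"] by (intro image_eqI[of _ _ "adj U *v v"]) (simp_all add: eigenspace_def inv)
  qed (use eq in \<open>auto simp: eigenspace_def\<close>)
qed

lemma dim_eigenspace_diagonalizes:
  assumes "diagonalizes U d M"
  shows "vec.dim (eigenspace M (of_real x)) = card {i. d i = x}"
proof -
  have "inj ((*v) U)"
    by (rule inj_on_inverseI[of _ "(*v) (adj U)"])
      (simp add: matrix_vector_mul_assoc unitary_opD[OF diagonalizesD(1)[OF assms]])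
  then show ?thesis
    unfolding eigenspace_diagonalizes[OF assms]
    using dim_substandard_cart[of "{i. d i = x}", where 'a = complex]
    by (subst vec.dim_image_eq) (auto intro: inj_on_subset)
qed

lemma subspace_eigenspace: "vec.subspace (eigenspace M c)"
  by (auto simp: vec.subspace_def eigenspace_def vec.add vec.scale vec.scale_right_distrib mult.commute)

lemma eigenspace_trivial_iff: "eigenspace M c = {0} \<longleftrightarrow> vec.dim (eigenspace M c) = 0"
  using vec.subspace_0[OF subspace_eigenspace[of M c]] by auto

text \<open>The list \<open>d\<close> repeats each eigenvalue as often as the dimension of its
  eigenspace, so grouping the indices by value gives the definition.\<close>

lemma von_neumann_entropy_diagonalizes:
  assumes "diagonalizes U d M"
  shows "von_neumann_entropy M = - (\<Sum>i\<in>UNIV. d i * log 2 (d i))"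
proof -
  have "{x. eigenspace M (of_real x) \<noteq> {0}} = range d"
    by (auto simp: eigenspace_trivial_iff dim_eigenspace_diagonalizes[OF assms] card_eq_0_iff)
  then have "von_neumann_entropy M = - (\<Sum>x\<in>range d. real (card {i. d i = x}) * (x * log 2 x))"
    by (simp add: von_neumann_entropy_def dim_eigenspace_diagonalizes[OF assms])
  also have "(\<Sum>x\<in>range d. real (card {i. d i = x}) * (x * log 2 x))
      = (\<Sum>x\<in>range d. \<Sum>i\<in>{i\<in>UNIV. d i = x}. d i * log 2 (d i))"
    by (intro sum.cong refl) simp
  also have "\<dots> = (\<Sum>i\<in>UNIV. d i * log 2 (d i))"
    by (rule sum.group) auto
  finally show ?thesis .
qed

lemma von_neumann_entropy_ln:
  assumes "diagonalizes U d M"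
  shows "von_neumann_entropy M = - (\<Sum>i\<in>UNIV. d i * ln (d i)) / ln 2"
  by (simp add: von_neumann_entropy_diagonalizes[OF assms] log_def sum_divide_distrib)

section \<open>Entropies of the two marginals of a pure state\<close>

text \<open>\<open>M\<close> maps the first eigenspace into the second, injectively, since
  \<open>M *v v = 0\<close> forces \<open>c *s v = 0\<close>.\<close>

lemma dim_eigenspace_swap_le:
  fixes M :: "complex ^ 'e::finite ^ 'p::finite" and M' :: "complex ^ 'p ^ 'e"
  assumes "c \<noteq> 0"
  shows "vec.dim (eigenspace (M' ** M) c) \<le> vec.dim (eigenspace (M ** M') c)"
proof -
  let ?E = "eigenspace (M' ** M) c"
  have "inj_on ((*v) M) (vec.span ?E)"
  proof (subst vec.inj_on_iff_eq_0)
    show "\<forall>v\<in>vec.span ?E. M *v v = 0 \<longrightarrow> v = 0"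
      using assms unfolding vec.span_eq_iff[THEN iffD2, OF subspace_eigenspace]
      by (auto simp: eigenspace_def simp flip: matrix_vector_mul_assoc)
  qed simp
  then have "vec.dim ?E = vec.dim ((*v) M ` ?E)"
    by (simp add: vec.dim_image_eq)
  also have "\<dots> \<le> vec.dim (eigenspace (M ** M') c)"
  proof (rule vec.dim_subset, safe)
    fix v assume "v \<in> ?E"
    then show "M *v v \<in> eigenspace (M ** M') c"
      by (simp add: eigenspace_def vec.scale flip: matrix_vector_mul_assoc)
  qed
  finally show ?thesis .
qed

text \<open>Nonzero eigenvalues have equal multiplicities on both sides; the eigenvalue 0, where
  they may differ, contributes nothing.\<close>

lemma von_neumann_entropy_mult_swap:
  fixes M :: "complex ^ 'e::finite ^ 'p::finite" and M' :: "complex ^ 'p ^ 'e"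
  shows "von_neumann_entropy (M ** M') = von_neumann_entropy (M' ** M)"
proof -
  have remove_0: "sum f A = sum f (A - {0})" if "f 0 = 0" for f :: "real \<Rightarrow> real" and A
    using that by (cases "finite A") (auto intro: sum.mono_neutral_right)
  have "vec.dim (eigenspace (M ** M') (of_real x)) = vec.dim (eigenspace (M' ** M) (of_real x))"
    if "x \<noteq> 0" for x :: real
    using that by (intro antisym dim_eigenspace_swap_le) simp_all
  then show ?thesis
    unfolding von_neumann_entropy_def eigenspace_trivial_iff
    by (subst (1 2) remove_0) (auto intro!: sum.cong simp del: vec.dim_eq_0)
qed

text \<open>The conjugated eigenvectors diagonalize the conjugated operator with the same
  \<open>d\<close>, which is real.\<close>

lemma von_neumann_entropy_cnj:
  assumes "adj M = M"
  shows "von_neumann_entropy (\<chi> i j. cnj (M $ i $ j)) = von_neumann_entropy M"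
proof -
  obtain U d where M: "diagonalizes U d M" using hermitian_diagonalizes[OF assms] .
  define conj :: "'a operator \<Rightarrow> 'a operator" where "conj X = (\<chi> i j. cnj (X $ i $ j))" for X
  have mult: "conj (X ** Y) = conj X ** conj Y" for X Y
    by (simp add: conj_def matrix_matrix_mult_def vec_eq_iff)
  have adj: "adj (conj X) = conj (adj X)" for X by (simp add: conj_def adj_def vec_eq_iff)
  have diag: "conj (diag_op e) = diag_op e" for e by (auto simp: conj_def diag_op_def vec_eq_iff)
  have one: "conj (mat 1) = mat 1" by (auto simp: conj_def mat_def vec_eq_iff)
  have "diagonalizes (conj U) d (conj M)"
    using diagonalizesD[OF M]
    by (simp add: diagonalizes_def unitary_op_def adj mult[symmetric] one) (simp add: mult diag)
  then show ?thesis
    using M unfolding conj_def by (simp add: von_neumann_entropy_diagonalizes)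
qed

text \<open>The two marginals of a pure state with amplitudes \<open>f p e\<close> are \<open>F F\<^sup>*\<close> and the
  complex conjugate of \<open>F\<^sup>* F\<close>.\<close>

lemma von_neumann_entropy_marginals:
  fixes f :: "'p::finite \<Rightarrow> 'e::finite \<Rightarrow> complex"
  shows "von_neumann_entropy (\<chi> p q. \<Sum>e\<in>UNIV. f p e * cnj (f q e))
    = von_neumann_entropy (\<chi> e e'. \<Sum>p\<in>UNIV. f p e * cnj (f p e'))"
proof -
  define F :: "complex ^ 'e ^ 'p" where "F = (\<chi> p e. f p e)"
  define F' :: "complex ^ 'p ^ 'e" where "F' = (\<chi> e p. cnj (f p e))"
  have "(\<chi> p q. \<Sum>e\<in>UNIV. f p e * cnj (f q e)) = F ** F'"
    by (simp add: F_def F'_def matrix_matrix_mult_def)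
  moreover have "(\<chi> e e'. \<Sum>p\<in>UNIV. f p e * cnj (f p e')) = (\<chi> i j. cnj ((F' ** F) $ i $ j))"
    by (simp add: F_def F'_def matrix_matrix_mult_def)
  moreover have "adj (F' ** F) = F' ** F"
    by (simp add: F_def F'_def matrix_matrix_mult_def adj_def vec_eq_iff mult.commute)
  ultimately show ?thesis
    by (simp add: von_neumann_entropy_cnj von_neumann_entropy_mult_swap[of F])
qed

section \<open>Pinching by a projective measurement\<close>

definition projective_measurement :: "('k::finite \<Rightarrow> 'n::finite operator) \<Rightarrow> bool" where
  "projective_measurement P \<longleftrightarrow> (\<forall>j. adj (P j) = P j) \<and>
     (\<forall>j k. P j ** P k = (if j = k then P j else 0)) \<and> (\<Sum>j\<in>UNIV. P j) = mat 1"

lemma projective_measurementD: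
  assumes "projective_measurement P"
  shows "adj (P j) = P j" "P j ** P k = (if j = k then P j else 0)" "(\<Sum>j\<in>UNIV. P j) = mat 1"
  using assms by (simp_all add: projective_measurement_def)

abbreviation pinching :: "('k::finite \<Rightarrow> 'n::finite operator) \<Rightarrow> 'n operator \<Rightarrow> 'n operator" where
  "pinching P \<equiv> kraus_map UNIV P"

lemma pinching_complete:
  assumes "projective_measurement P"
  shows "(\<Sum>j\<in>UNIV. adj (P j) ** P j) = mat 1"
  by (simp add: projective_measurementD[OF assms])

text \<open>Orthogonality of the projections reduces both sides to
  \<open>P j ** X ** P j\<close>.\<close>

lemma pinching_commutes:
  assumes P: "projective_measurement P"
  shows "P j ** pinching P X = pinching P X ** P j"
proof -
  have "P j ** (P k ** X ** P k) = (if j = k then P j ** X ** P j else 0)"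
    "(P k ** X ** P k) ** P j = (if k = j then P j ** X ** P j else 0)" for k
    using projective_measurementD(2)[OF P, of j k] projective_measurementD(2)[OF P, of k j]
    by (auto simp: matrix_mul_assoc) (simp_all add: matrix_mul_assoc[symmetric])
  then show ?thesis
    by (simp add: kraus_map_def projective_measurementD(1)[OF P] matrix_mult_sum_left matrix_mult_sum_right)
qed

lemma pinching_fixed:
  assumes P: "projective_measurement P" and comm: "\<And>j. P j ** X = X ** P j"
  shows "pinching P X = X"
proof -
  have "P j ** X ** P j = X ** P j" for j
    by (simp add: comm projective_measurementD(2)[OF P] flip: matrix_mul_assoc)
  then show ?thesis
    by (simp add: kraus_map_def projective_measurementD(1,3)[OF P] flip: matrix_mult_sum_right)
qed

lemma pinching_idem:
  assumes "projective_measurement P"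
  shows "pinching P (pinching P X) = pinching P X"
  by (intro pinching_fixed pinching_commutes assms)

text \<open>Pinching is its own dual and fixes \<open>L\<close>.\<close>

lemma trace_pinching_mult:
  assumes P: "projective_measurement P" and comm: "\<And>j. P j ** L = L ** P j"
  shows "trace (pinching P X ** L) = trace (X ** L)"
  using trace_mult_kraus_map[of L UNIV P X] pinching_fixed[OF assms]
  by (simp add: projective_measurementD(1)[OF P] trace_mul_sym[of _ L])

text \<open>The form of the pinched operator at \<open>v\<close> is the sum of the forms of
  \<open>M\<close> at the \<open>P j *v v\<close>. If it vanishes, \<open>M\<close> kills each of
  these vectors, hence their sum \<open>v\<close>.\<close>

lemma kernel_le_pinching:
  assumes P: "projective_measurement P" and "psd M"
  shows "kernel_le (pinching P M) M"
  unfolding kernel_le_def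
proof (intro allI impI)
  fix v assume "Re (cinner v (pinching P M *v v)) = 0"
  then have "\<forall>j. Re (cinner (P j *v v) (M *v (P j *v v))) = 0"
    using \<open>psd M\<close>
    by (simp add: form_kraus_map sum_nonneg_eq_0_iff psd_form_nonneg projective_measurementD(1)[OF P])
  then have "M *v (P j *v v) = 0" for j using psd_kernel[OF \<open>psd M\<close>] by blast
  then have "M *v ((\<Sum>j\<in>UNIV. P j) *v v) = 0"
    by (simp add: matrix_vector_mult_sum_left vec.sum)
  then show "Re (cinner v (M *v v)) = 0" by (simp add: projective_measurementD(3)[OF P])
qed

text \<open>In the eigenbasis, commuting with \<open>M\<close> means that \<open>R $ i $ j\<close>
  vanishes unless \<open>d i = d j\<close>, and then \<open>g (d i) = g (d j)\<close>.\<close>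

lemma diagonalizes_commute:
  assumes M: "diagonalizes U d M" and comm: "P ** M = M ** P"
  shows "P ** (U ** diag_op (\<lambda>i. g (d i)) ** adj U) = (U ** diag_op (\<lambda>i. g (d i)) ** adj U) ** P"
proof -
  note U = diagonalizesD(1)[OF M]
  define R where "R = adj U ** P ** U"
  have "adj U ** (P ** M) ** U = adj U ** (M ** P) ** U" by (simp add: comm)
  then have "R ** diag_op d = diag_op d ** R"
    by (simp add: diagonalizesD(2)[OF M] R_def matrix_mul_assoc unitary_cancel[OF U] unitary_opD[OF U])
  then have "R $ i $ j * of_real (d j) = of_real (d i) * R $ i $ j" for i j
    by (metis diag_op_mult mult_diag_op)
  then have "R $ i $ j = 0 \<or> d i = d j" for i j
    by (metis mult.commute mult_cancel_right of_real_eq_iff)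
  then have R: "R ** diag_op (\<lambda>i. g (d i)) = diag_op (\<lambda>i. g (d i)) ** R"
    by (force simp: vec_eq_iff diag_op_mult mult_diag_op)
  have P: "P = U ** R ** adj U"
    by (simp add: R_def matrix_mul_assoc unitary_cancel[OF U] unitary_opD[OF U])
  have "P ** (U ** diag_op (\<lambda>i. g (d i)) ** adj U) = U ** (R ** diag_op (\<lambda>i. g (d i))) ** adj U"
    by (simp add: P matrix_mul_assoc unitary_cancel[OF U])
  also have "\<dots> = (U ** diag_op (\<lambda>i. g (d i)) ** adj U) ** P"
    by (simp add: R) (simp add: P matrix_mul_assoc unitary_cancel[OF U])
  finally show ?thesis .
qed

lemma trace_mult_log_self:
  assumes M: "diagonalizes U d M"
  shows "trace (M ** (U ** diag_op (\<lambda>i. ln (d i)) ** adj U)) = of_real (\<Sum>i\<in>UNIV. d i * ln (d i))"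
proof -
  note U = diagonalizesD(1)[OF M]
  have "M ** (U ** diag_op (\<lambda>i. ln (d i)) ** adj U) = U ** (diag_op d ** diag_op (\<lambda>i. ln (d i))) ** adj U"
    by (simp add: diagonalizesD(2)[OF M] matrix_mul_assoc unitary_cancel[OF U])
  then show ?thesis
    by (simp add: trace_conj_unitary[OF U]) (simp add: trace_def diag_op_mult, simp add: diag_op_def)
qed

text \<open>The logarithm of \<open>N\<close> commutes with the projections, so
  \<open>tr (M ln N) = tr (N ln N)\<close>, and the entropy gain of \<open>M\<close> times
  \<open>ln 2\<close> is the relative entropy of \<open>M\<close> and \<open>N\<close>. By
  \<open>fixed\<close>, the logarithm of \<open>N'\<close> commutes too, so the relative entropy of
  \<open>M'\<close> and \<open>N'\<close> is \<open>ln 2\<close> times the gain of \<open>M'\<close>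
  plus the relative entropy of \<open>R\<close> and \<open>N'\<close>. Klein's inequality discards
  the last term, and monotonicity does the rest.\<close>

theorem pinching_entropy_gain_kraus_map:
  assumes P: "projective_measurement P" and "psd M"
    and I: "finite I" and K: "(\<Sum>i\<in>I. adj (K i) ** K i) = mat 1"
    and fixed: "pinching P (kraus_map I K (pinching P M)) = kraus_map I K (pinching P M)"
  shows "von_neumann_entropy (pinching P (kraus_map I K M)) - von_neumann_entropy (kraus_map I K M)
    \<le> von_neumann_entropy (pinching P M) - von_neumann_entropy M"
proof -
  define N where "N = pinching P M"
  define M' N' R where "M' = kraus_map I K M" and "N' = kraus_map I K N" and "R = pinching P M'"
  have psd: "psd N" "psd M'" "psd N'" "psd R"
    unfolding N_def M'_def N'_def R_def by (intro psd_kraus_map \<open>psd M\<close>)+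
  obtain U l where dM: "diagonalizes U l M" using hermitian_diagonalizes psd_adj[OF \<open>psd M\<close>] .
  obtain V m where dN: "diagonalizes V m N" using hermitian_diagonalizes psd_adj[OF psd(1)] .
  obtain U' l' where dM': "diagonalizes U' l' M'" using hermitian_diagonalizes psd_adj[OF psd(2)] .
  obtain V' m' where dN': "diagonalizes V' m' N'" using hermitian_diagonalizes psd_adj[OF psd(3)] .
  obtain W r where dR: "diagonalizes W r R" using hermitian_diagonalizes psd_adj[OF psd(4)] .
  have le: "kernel_le N M" unfolding N_def by (rule kernel_le_pinching[OF P \<open>psd M\<close>])
  then have "kernel_le N' M'"
    unfolding M'_def N'_def by (rule kernel_le_kraus_map[OF I psd(1)])
  \<comment> \<open>Pinching both operators preserves the inclusion, and \<open>N'\<close> is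
    unchanged by it.\<close>
  then have "kernel_le (pinching P N') R"
    unfolding R_def by (rule kernel_le_kraus_map[OF finite psd(3)])
  then have "kernel_le N' R" by (simp add: N'_def N_def fixed)
  moreover have "trace R = trace N'"
    unfolding R_def M'_def N'_def N_def
    by (simp add: trace_kraus_map[OF K] trace_kraus_map[OF pinching_complete[OF P]])
  ultimately have klein: "0 \<le> relative_entropy W r V' m'"
    using relative_entropy_nonneg psd dR dN' by blast
  have commN: "P j ** N = N ** P j" for j unfolding N_def by (rule pinching_commutes[OF P])
  have commN': "P j ** N' = N' ** P j" for j
    using pinching_commutes[OF P, of j "kraus_map I K N"] fixed by (simp add: N'_def N_def)
  have 1: "relative_entropy U l V m = (\<Sum>i\<in>UNIV. l i * ln (l i)) - (\<Sum>i\<in>UNIV. m i * ln (m i))"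
    using trace_pinching_mult[OF P diagonalizes_commute[OF dN commN], of M ln] trace_mult_log_self[OF dN]
    unfolding relative_entropy_trace[OF dM] N_def[symmetric] by (metis Re_complex_of_real)
  have "relative_entropy U' l' V' m' - (\<Sum>i\<in>UNIV. l' i * ln (l' i))
      = relative_entropy W r V' m' - (\<Sum>i\<in>UNIV. r i * ln (r i))"
    using trace_pinching_mult[OF P diagonalizes_commute[OF dN' commN'], of M' ln]
    unfolding relative_entropy_trace[OF dM'] relative_entropy_trace[OF dR] R_def[symmetric] by simp
  moreover have "relative_entropy U' l' V' m' \<le> relative_entropy U l V m"
    by (rule relative_entropy_kraus_map_le[OF I K \<open>psd M\<close> psd(1) le dM dN
          dM'[unfolded M'_def] dN'[unfolded N'_def]])
  ultimately have "(\<Sum>i\<in>UNIV. l' i * ln (l' i)) - (\<Sum>i\<in>UNIV. r i * ln (r i))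
      \<le> (\<Sum>i\<in>UNIV. l i * ln (l i)) - (\<Sum>i\<in>UNIV. m i * ln (m i))"
    using klein 1 by linarith
  then show ?thesis
    unfolding M'_def[symmetric] R_def[symmetric] N_def[symmetric]
      von_neumann_entropy_ln[OF dM] von_neumann_entropy_ln[OF dN]
      von_neumann_entropy_ln[OF dM'] von_neumann_entropy_ln[OF dR]
    by (simp add: divide_right_mono flip: diff_divide_distrib)
qed

section \<open>The discord measure\<close>

lemma ketbra_mult_vec: "ketbra u v *v w = cinner v w *s u"
  by (simp add: ketbra_def cinner_def matrix_vector_mult_def vec_eq_iff sum_distrib_left
      sum_distrib_right mult_ac)

lemma mult_ketbra: "X ** ketbra u v = ketbra (X *v u) v"
  by (simp add: ketbra_def matrix_vector_mult_def matrix_matrix_mult_def vec_eq_iff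
      sum_distrib_right mult.assoc)

lemma ketbra_mult: "ketbra u v ** X = ketbra u (adj X *v v)"
  by (simp add: ketbra_def matrix_vector_mult_def matrix_matrix_mult_def adj_def vec_eq_iff
      sum_distrib_left mult_ac)

lemma ketbra_scale: "ketbra (c *s u) v = ketbra u (cnj c *s v)"
  by (simp add: ketbra_def vec_eq_iff mult_ac)

lemma ketbra_zero [simp]: "ketbra 0 v = 0"
  by (simp add: ketbra_def vec_eq_iff)

lemma trace_ketbra: "trace (ketbra u v) = cinner v u"
  by (simp add: trace_def ketbra_def cinner_def mult.commute)

lemma trace_tensor: "trace (M \<otimes>\<^sub>o N) = trace M * trace N"
  by (simp add: trace_def tensor_def sum_UNIV_prod sum_product)

lemma trace_scaleR: "trace (c *\<^sub>R M) = of_real c * trace M" for M :: "'n::finite operator"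
  by (simp add: trace_def sum_distrib_left) (simp add: scaleR_conv_of_real)

lemma tensor_zero_left [simp]: "0 \<otimes>\<^sub>o N = 0"
  by (simp add: tensor_def vec_eq_iff)

text \<open>The form at \<open>w\<close> is the form of \<open>N\<close> at the partial inner
  product of \<open>v\<close> with \<open>w\<close>.\<close>

lemma psd_ketbra_tensor:
  assumes "psd N"
  shows "psd (ketbra v v \<otimes>\<^sub>o N)"
proof -
  have "cinner w ((ketbra v v \<otimes>\<^sub>o N) *v w) = cinner (\<chi> b. \<Sum>a\<in>UNIV. cnj (v $ a) * w $ (a, b))
      (N *v (\<chi> b. \<Sum>a\<in>UNIV. cnj (v $ a) * w $ (a, b)))" (is "?L = ?R") for w
  proof -
    have "?L = (\<Sum>a\<in>UNIV. \<Sum>b\<in>UNIV. \<Sum>a'\<in>UNIV. \<Sum>b'\<in>UNIV.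
        v $ a * cnj (w $ (a, b)) * N $ b $ b' * cnj (v $ a') * w $ (a', b'))"
      by (simp add: cinner_def tensor_def ketbra_def matrix_vector_mult_def sum_UNIV_prod
          sum_distrib_left mult_ac)
    also have "\<dots> = (\<Sum>b\<in>UNIV. \<Sum>a\<in>UNIV. \<Sum>b'\<in>UNIV. \<Sum>a'\<in>UNIV.
        v $ a * cnj (w $ (a, b)) * N $ b $ b' * cnj (v $ a') * w $ (a', b'))"
      by (rule trans[OF sum.swap]) (intro sum.cong refl, rule sum.swap)
    also have "\<dots> = (\<Sum>b\<in>UNIV. \<Sum>b'\<in>UNIV. \<Sum>a'\<in>UNIV. \<Sum>a\<in>UNIV.
        v $ a * cnj (w $ (a, b)) * N $ b $ b' * cnj (v $ a') * w $ (a', b'))"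
      by (rule sum.cong[OF refl], rule trans[OF sum.swap], rule sum.cong[OF refl], rule sum.swap)
    also have "\<dots> = ?R"
      by (simp add: cinner_def matrix_vector_mult_def sum_distrib_left sum_distrib_right mult_ac)
    finally show ?thesis .
  qed
  then show ?thesis using assms by (simp add: psd_def adj_tensor adj_ketbra)
qed

lemma psd_scaleR:
  assumes "psd M" "0 \<le> c"
  shows "psd (c *\<^sub>R M)"
proof -
  have "adj (c *\<^sub>R M) = c *\<^sub>R adj M" by (simp add: adj_def vec_eq_iff)
  moreover have "cinner v ((c *\<^sub>R M) *v v) = of_real c * cinner v (M *v v)" for v
    by (simp add: cinner_def matrix_vector_mult_def sum_distrib_left)
      (simp add: scaleR_conv_of_real mult_ac)
  ultimately show ?thesis using assms by (simp add: psd_def)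
qed

section \<open>Operators diagonal in an orthonormal basis\<close>

text \<open>Orthonormality is \<open>adj U ** U = mat 1\<close> for the matrix with columns
  \<open>J j\<close>, and a left inverse of a square matrix is a right inverse.\<close>

lemma orthonormal_basis_resolution:
  assumes "orthonormal_basis J"
  shows "(\<Sum>j\<in>UNIV. ketbra (J j) (J j)) = mat 1"
proof -
  define U where "U = (\<chi> i j. J j $ i)"
  have "cinner (J i) (J j) = (if i = j then 1 else 0)" for i j
    using assms by (simp add: orthonormal_basis_def)
  then have "adj U ** U = mat 1"
    by (simp add: vec_eq_iff[of "adj U ** U"] vec_eq_iff[of "(adj U ** U) $ _"] U_def adj_def
        matrix_matrix_mult_def mat_def cinner_def)
  then have "U ** adj U = mat 1" using matrix_left_right_inverse by blast
  moreover have "(\<Sum>j\<in>UNIV. ketbra (J j) (J j)) = U ** adj U"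
    by (simp add: vec_eq_iff U_def adj_def matrix_matrix_mult_def ketbra_def)
  ultimately show ?thesis by simp
qed

lemma orthonormal_basis_expansion:
  assumes "orthonormal_basis J"
  shows "v = (\<Sum>j\<in>UNIV. cinner (J j) v *s J j)"
proof -
  have "(\<Sum>j\<in>UNIV. ketbra (J j) (J j)) *v v = v"
    by (simp add: orthonormal_basis_resolution[OF assms])
  then show ?thesis by (simp add: matrix_vector_mult_sum_left ketbra_mult_vec)
qed

lemma diagonal_in_eigenvector:
  assumes J: "orthonormal_basis J" and X: "diagonal_in J X"
  shows "X *v J k = cinner (J k) (X *v J k) *s J k"
proof -
  have "X *v J k = (\<Sum>j\<in>UNIV. cinner (J j) (X *v J k) *s J j)"
    by (rule orthonormal_basis_expansion[OF J])
  also have "\<dots> = (\<Sum>j\<in>UNIV. if j = k then cinner (J k) (X *v J k) *s J k else 0)"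
    using X by (intro sum.cong refl) (simp add: diagonal_in_def)
  finally show ?thesis by simp
qed

text \<open>\<open>J k\<close> is an eigenvector of \<open>X\<close> and, for the conjugate
  eigenvalue, of \<open>adj X\<close>, so both products are the same multiple of the
  projector.\<close>

lemma diagonal_in_commutes:
  assumes J: "orthonormal_basis J" and X: "diagonal_in J X"
  shows "ketbra (J k) (J k) ** X = X ** ketbra (J k) (J k)"
proof -
  have entry: "cinner (J i) (adj X *v J j) = cnj (cinner (J j) (X *v J i))" for i j
    by (simp add: cinner_adj[of _ "adj X"] cnj_cinner)
  then have "diagonal_in J (adj X)" using X by (simp add: diagonal_in_def)
  from diagonal_in_eigenvector[OF J this, of k]
  have "adj X *v J k = cnj (cinner (J k) (X *v J k)) *s J k" by (simp add: entry)
  then have "ketbra (J k) (J k) ** X = ketbra (cinner (J k) (X *v J k) *s J k) (J k)"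
    by (simp only: ketbra_mult ketbra_scale)
  also have "\<dots> = X ** ketbra (J k) (J k)"
    by (subst diagonal_in_eigenvector[OF J X, symmetric]) (simp only: mult_ketbra)
  finally show ?thesis .
qed

section \<open>Dephasing of A and its effect on the marginals\<close>

definition basis_measurement :: "('a::finite \<Rightarrow> complex ^ 'a) \<Rightarrow> 'a \<Rightarrow> ('a \<times> 'b::finite) operator" where
  "basis_measurement J j = ketbra (J j) (J j) \<otimes>\<^sub>o mat 1"

lemma ketbra_orthonormal_mult:
  assumes "orthonormal_basis J"
  shows "ketbra (J j) (J j) ** ketbra (J k) (J k) = (if j = k then ketbra (J j) (J j) else 0)"
  using assms by (simp add: mult_ketbra ketbra_mult_vec orthonormal_basis_def)

lemma projective_basis_measurement:
  assumes "orthonormal_basis J"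
  shows "projective_measurement (basis_measurement J)"
  unfolding projective_measurement_def basis_measurement_def
  by (simp add: adj_tensor adj_ketbra tensor_mult ketbra_orthonormal_mult[OF assms]
      orthonormal_basis_resolution[OF assms] tensor_mat_1 flip: tensor_sum_left)

lemma dephase_A_eq_pinching: "dephase_A J = pinching (basis_measurement J)"
  by (simp add: fun_eq_iff dephase_A_def kraus_map_def basis_measurement_def adj_tensor adj_ketbra)

text \<open>The second factor is the partial matrix element of \<open>M\<close> at \<open>v\<close>;
  hence dephasing yields a sum of product terms.\<close>

lemma project_A:
  "(ketbra v v \<otimes>\<^sub>o mat 1) ** M ** (ketbra v v \<otimes>\<^sub>o mat 1) =
   ketbra v v \<otimes>\<^sub>o (\<chi> b b'. \<Sum>x\<in>UNIV. \<Sum>y\<in>UNIV. cnj (v $ x) * M $ (x, b) $ (y, b') * v $ y)"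
proof -
  have left: "((ketbra v v \<otimes>\<^sub>o mat 1) ** X) $ (a, b) $ q = v $ a * (\<Sum>x\<in>UNIV. cnj (v $ x) * X $ (x, b) $ q)"
    for X :: "('a \<times> 'b) operator" and a b q
    by (simp add: matrix_matrix_mult_def tensor_def ketbra_def mat_def sum_UNIV_prod if_distrib
        if_distribR sum_distrib_left mult.assoc cong: if_cong)
  have right: "(X ** (ketbra v v \<otimes>\<^sub>o mat 1)) $ p $ (a, b) = (\<Sum>y\<in>UNIV. X $ p $ (y, b) * v $ y) * cnj (v $ a)"
    for X :: "('a \<times> 'b) operator" and a b p
    by (simp add: matrix_matrix_mult_def tensor_def ketbra_def mat_def sum_UNIV_prod if_distrib
        if_distribR sum_distrib_right mult.assoc cong: if_cong)
  show ?thesis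
    by (simp add: vec_eq_iff split_paired_All right left)
      (simp add: tensor_def ketbra_def sum_distrib_left sum_distrib_right mult_ac,
        intro allI, rule sum.swap)
qed

text \<open>The amplitudes are curried so that exchanging B and E is an exchange of
  arguments.\<close>

definition reduced_state :: "('a::finite \<Rightarrow> 'b::finite \<Rightarrow> 'e::finite \<Rightarrow> complex) \<Rightarrow> ('a \<times> 'b) operator" where
  "reduced_state \<Phi> = (\<chi> p q. \<Sum>e\<in>UNIV. \<Phi> (fst p) (snd p) e * cnj (\<Phi> (fst q) (snd q) e))"

text \<open>Dephasing \<open>A\<close> amounts to copying its basis value into a second register: up to the names of
  the systems, the dephased marginals on \<open>AB\<close> and \<open>AE\<close> are the two marginals of one pure state.\<close>

definition copied_amplitude ::
    "('a::finite \<Rightarrow> complex ^ 'a) \<Rightarrow> ('a \<Rightarrow> 'b \<Rightarrow> 'e \<Rightarrow> complex) \<Rightarrow> 'a \<times> 'b \<Rightarrow> 'a \<times> 'e \<Rightarrow> complex" where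
  "copied_amplitude J \<Phi> p r =
     (\<Sum>j\<in>UNIV. J j $ fst p * J j $ fst r * (\<Sum>x\<in>UNIV. cnj (J j $ x) * \<Phi> x (snd p) (snd r)))"

text \<open>Tracing out the copy of A produces inner products of the \<open>J j\<close> and
  \<open>J k\<close>, which kill the cross terms between different outcomes.\<close>

lemma dephase_A_reduced_state:
  assumes J: "orthonormal_basis J"
  shows "dephase_A J (reduced_state \<Phi>) =
    (\<chi> p q. \<Sum>r\<in>UNIV. copied_amplitude J \<Phi> p r * cnj (copied_amplitude J \<Phi> q r))"
proof -
  \<comment> \<open>The amplitude left on the other two systems when A is projected onto
    \<open>J j\<close>.\<close>
  define g where "g j b e = (\<Sum>x\<in>UNIV. cnj (J j $ x) * \<Phi> x b e)" for j b e
  have inner: "(\<Sum>x\<in>UNIV. \<Sum>y\<in>UNIV. cnj (J j $ x) * reduced_state \<Phi> $ (x, b) $ (y, b') * J j $ y)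
      = (\<Sum>e\<in>UNIV. g j b e * cnj (g j b' e))" for j b b'
  proof -
    have "(\<Sum>x\<in>UNIV. \<Sum>y\<in>UNIV. cnj (J j $ x) * reduced_state \<Phi> $ (x, b) $ (y, b') * J j $ y)
        = (\<Sum>x\<in>UNIV. \<Sum>y\<in>UNIV. \<Sum>e\<in>UNIV. cnj (J j $ x) * \<Phi> x b e * (J j $ y * cnj (\<Phi> y b' e)))"
      by (simp add: reduced_state_def sum_distrib_left sum_distrib_right mult_ac)
    also have "\<dots> = (\<Sum>x\<in>UNIV. \<Sum>e\<in>UNIV. \<Sum>y\<in>UNIV. cnj (J j $ x) * \<Phi> x b e * (J j $ y * cnj (\<Phi> y b' e)))"
      by (intro sum.cong refl sum.swap)
    also have "\<dots> = (\<Sum>e\<in>UNIV. \<Sum>x\<in>UNIV. \<Sum>y\<in>UNIV. cnj (J j $ x) * \<Phi> x b e * (J j $ y * cnj (\<Phi> y b' e)))"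
      by (rule sum.swap)
    also have "\<dots> = (\<Sum>e\<in>UNIV. g j b e * cnj (g j b' e))"
      by (simp add: g_def sum_product)
    finally show ?thesis .
  qed
  have lhs: "dephase_A J (reduced_state \<Phi>) $ (a, b) $ (a', b')
      = (\<Sum>j\<in>UNIV. J j $ a * cnj (J j $ a') * (\<Sum>e\<in>UNIV. g j b e * cnj (g j b' e)))" for a b a' b'
    unfolding dephase_A_def project_A inner by (simp add: tensor_def ketbra_def)
  have rhs: "(\<Sum>r\<in>UNIV. copied_amplitude J \<Phi> (a, b) r * cnj (copied_amplitude J \<Phi> (a', b') r))
      = (\<Sum>j\<in>UNIV. J j $ a * cnj (J j $ a') * (\<Sum>e\<in>UNIV. g j b e * cnj (g j b' e)))" for a b a' b'
  proof -
    have orth: "(\<Sum>x\<in>UNIV. J j $ x * cnj (J k $ x)) = (if j = k then 1 else 0)" for j k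
      using J by (auto simp: orthonormal_basis_def cinner_def mult.commute)
    define h where "h j k e = J j $ a * g j b e * (cnj (J k $ a') * cnj (g k b' e))" for j k e
    have "(\<Sum>r\<in>UNIV. copied_amplitude J \<Phi> (a, b) r * cnj (copied_amplitude J \<Phi> (a', b') r))
        = (\<Sum>x\<in>UNIV. \<Sum>e\<in>UNIV. \<Sum>j\<in>UNIV. \<Sum>k\<in>UNIV. h j k e * (J j $ x * cnj (J k $ x)))"
      by (simp add: sum_UNIV_prod copied_amplitude_def g_def[symmetric] sum_product h_def mult_ac)
    also have "\<dots> = (\<Sum>e\<in>UNIV. \<Sum>j\<in>UNIV. \<Sum>k\<in>UNIV. \<Sum>x\<in>UNIV. h j k e * (J j $ x * cnj (J k $ x)))"
      by (rule trans[OF sum.swap], rule sum.cong[OF refl], rule trans[OF sum.swap],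
          rule sum.cong[OF refl], rule sum.swap)
    also have "\<dots> = (\<Sum>e\<in>UNIV. \<Sum>j\<in>UNIV. h j j e)"
      by (simp add: sum_distrib_left[symmetric] orth if_distrib cong: if_cong)
    also have "\<dots> = (\<Sum>j\<in>UNIV. J j $ a * cnj (J j $ a') * (\<Sum>e\<in>UNIV. g j b e * cnj (g j b' e)))"
      by (subst sum.swap) (simp add: h_def sum_distrib_left mult_ac)
    finally show ?thesis .
  qed
  show ?thesis by (simp add: vec_eq_iff split_paired_All lhs rhs)
qed

text \<open>The copied amplitude is unchanged when the two copies of A are exchanged together with B
  and E, so these are complementary marginals of one vector.\<close>

lemma von_neumann_entropy_dephase_A_swap:
  assumes J: "orthonormal_basis J"
  shows "von_neumann_entropy (dephase_A J (reduced_state \<Phi>))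
    = von_neumann_entropy (dephase_A J (reduced_state (\<lambda>a e b. \<Phi> a b e)))"
proof -
  have "copied_amplitude J (\<lambda>a e b. \<Phi> a b e) r p = copied_amplitude J \<Phi> p r" for r p
    by (simp add: copied_amplitude_def mult.commute[of "J _ $ fst r"])
  then show ?thesis
    unfolding dephase_A_reduced_state[OF J] by (subst von_neumann_entropy_marginals) simp
qed

section \<open>Independence of the purification\<close>

definition entropy_gain :: "('a::finite \<Rightarrow> complex ^ 'a) \<Rightarrow> ('a \<times> 'b::finite) operator \<Rightarrow> real" where
  "entropy_gain J \<rho> = von_neumann_entropy (dephase_A J \<rho>) - von_neumann_entropy \<rho>"

text \<open>E has the entropy of the complementary AB, and dephased AE that of dephased AB. So the
  purification enters only through its marginal \<open>\<rho>\<close>.\<close>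

lemma entropy_Z_given_E_eq:
  assumes J: "orthonormal_basis J" and \<Psi>: "purification \<Psi> \<rho>"
  shows "entropy_Z_given_E J \<Psi> = entropy_gain J \<rho>"
proof -
  have E: "trace_E (ketbra \<Psi> \<Psi>) = reduced_state (\<lambda>a b e. \<Psi> $ (a, b, e))"
    by (simp add: trace_E_def reduced_state_def ketbra_def)
  have B: "trace_B (ketbra \<Psi> \<Psi>) = reduced_state (\<lambda>a e b. \<Psi> $ (a, b, e))"
    by (simp add: trace_B_def reduced_state_def ketbra_def)
  have AB: "trace_AB (ketbra \<Psi> \<Psi>)
      = (\<chi> e e'. \<Sum>p\<in>UNIV. \<Psi> $ (fst p, snd p, e) * cnj (\<Psi> $ (fst p, snd p, e')))"
    by (simp add: trace_AB_def ketbra_def sum_UNIV_prod)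
  have "von_neumann_entropy (trace_AB (ketbra \<Psi> \<Psi>)) = von_neumann_entropy (trace_E (ketbra \<Psi> \<Psi>))"
    unfolding AB E reduced_state_def
    by (rule von_neumann_entropy_marginals[of "\<lambda>p e. \<Psi> $ (fst p, snd p, e)", symmetric])
  moreover have "von_neumann_entropy (dephase_A J (trace_B (ketbra \<Psi> \<Psi>)))
      = von_neumann_entropy (dephase_A J (trace_E (ketbra \<Psi> \<Psi>)))"
    unfolding B E by (rule von_neumann_entropy_dephase_A_swap[OF J, symmetric])
  ultimately show ?thesis
    using \<Psi> by (simp add: entropy_Z_given_E_def entropy_gain_def purification_def)
qed

text \<open>E labels the eigenvectors of \<open>\<rho>\<close>: column \<open>q\<close> of
  \<open>U\<close>, weighted by \<open>sqrt (d q)\<close>, is paired with the label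
  \<open>q\<close>.\<close>

lemma purification_exists:
  fixes \<rho> :: "('a::finite \<times> 'b::finite) operator"
  assumes "density_operator \<rho>"
  shows "\<exists>\<Psi> :: complex ^ ('a \<times> 'b \<times> ('a \<times> 'b)). purification \<Psi> \<rho>"
proof -
  have psd: "psd \<rho>" and tr: "trace \<rho> = 1" using assms by (simp_all add: density_operator_iff)
  obtain U d where \<rho>: "diagonalizes U d \<rho>" using hermitian_diagonalizes psd_adj[OF psd] .
  define \<Psi> :: "complex ^ ('a \<times> 'b \<times> ('a \<times> 'b))"
    where "\<Psi> = (\<chi> p. case p of (a, b, q) \<Rightarrow> U $ (a, b) $ q * of_real (sqrt (d q)))"
  have sq: "of_real (sqrt (d q)) * of_real (sqrt (d q)) = (of_real (d q) :: complex)" for q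
    using psd_diagonalizes_nonneg[OF \<rho> psd, of q] by (simp flip: of_real_mult)
  have "\<Psi> $ (a, b, q) * cnj (\<Psi> $ (a', b', q)) = U $ (a, b) $ q * of_real (d q) * adj U $ q $ (a', b')"
    for a b a' b' q
    by (simp add: \<Psi>_def adj_def sq[symmetric] mult_ac)
  then have E: "trace_E (ketbra \<Psi> \<Psi>) = \<rho>"
    unfolding diagonalizesD(2)[OF \<rho>]
    by (simp add: trace_E_def ketbra_def vec_eq_iff matrix_matrix_mult_def[of "U ** diag_op d"]
        mult_diag_op)
  have "trace (trace_E (ketbra \<Psi> \<Psi>)) = cinner \<Psi> \<Psi>"
    by (simp add: trace_def trace_E_def ketbra_def cinner_def sum_UNIV_prod mult.commute)
  then have "of_real ((norm \<Psi>)\<^sup>2) = (of_real 1 :: complex)" by (simp add: E tr cinner_self)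
  then have "(norm \<Psi>)\<^sup>2 = 1" by (simp only: of_real_eq_iff)
  then have "norm \<Psi> = 1" using norm_ge_zero[of \<Psi>] by (auto simp: power2_eq_1_iff)
  with E show ?thesis by (auto simp: purification_def)
qed

lemma S_Z_E_eq:
  assumes "orthonormal_basis J" "density_operator \<rho>"
  shows "S_Z_E J \<rho> = entropy_gain J \<rho>"
  unfolding S_Z_E_def
  using entropy_Z_given_E_eq[OF assms(1) someI_ex[OF purification_exists[OF assms(2)]]] .

text \<open>Take the pinching itself as the channel: its output gains nothing from a second
  pinching.\<close>

lemma entropy_gain_nonneg:
  assumes "orthonormal_basis J" "psd \<rho>"
  shows "0 \<le> entropy_gain J \<rho>"
proof -
  note P = projective_basis_measurement[OF assms(1)]
  show ?thesis
    using pinching_entropy_gain_kraus_map[OF P assms(2) finite pinching_complete[OF P]]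
    by (simp add: pinching_idem[OF P] entropy_gain_def dephase_A_eq_pinching)
qed

section \<open>IQ states and SQI operations\<close>

lemma density_operator_ketbra_tensor:
  assumes "cinner v v = 1" "density_operator \<tau>"
  shows "density_operator (ketbra v v \<otimes>\<^sub>o \<tau>)"
  using assms by (simp add: density_operator_iff psd_ketbra_tensor trace_tensor trace_ketbra)

lemma IQ_state_density_operator:
  assumes J: "orthonormal_basis J" and "IQ_state J \<rho>"
  shows "density_operator \<rho>"
proof -
  obtain p \<tau> where p: "\<And>j. 0 \<le> p j" "(\<Sum>j\<in>UNIV. p j) = 1" and \<tau>: "\<And>j. density_operator (\<tau> j)"
    and \<rho>: "\<rho> = (\<Sum>j\<in>UNIV. p j *\<^sub>R (ketbra (J j) (J j) \<otimes>\<^sub>o \<tau> j))"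
    using assms(2) by (auto simp: IQ_state_def)
  have "cinner (J j) (J j) = 1" for j using J by (simp add: orthonormal_basis_def)
  then have "density_operator (ketbra (J j) (J j) \<otimes>\<^sub>o \<tau> j)" for j
    by (rule density_operator_ketbra_tensor[OF _ \<tau>])
  then show ?thesis
    using p unfolding density_operator_iff \<rho>
    by (auto intro!: psd_sum psd_scaleR simp: trace_sum trace_scaleR simp flip: of_real_sum)
qed

lemma basis_measurement_commutes:
  assumes "ketbra (J k) (J k) ** X = X ** ketbra (J k) (J k)"
  shows "basis_measurement J k ** (X \<otimes>\<^sub>o Y) = (X \<otimes>\<^sub>o Y) ** basis_measurement J k"
  by (simp add: basis_measurement_def tensor_mult assms)

lemma IQ_state_dephase_A:
  assumes J: "orthonormal_basis J" and "IQ_state J \<rho>"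
  shows "dephase_A J \<rho> = \<rho>"
proof -
  obtain p \<tau> where \<rho>: "\<rho> = (\<Sum>j\<in>UNIV. p j *\<^sub>R (ketbra (J j) (J j) \<otimes>\<^sub>o \<tau> j))"
    using assms(2) by (auto simp: IQ_state_def)
  have "basis_measurement J k ** (ketbra (J j) (J j) \<otimes>\<^sub>o \<tau> j)
      = (ketbra (J j) (J j) \<otimes>\<^sub>o \<tau> j) ** basis_measurement J k" for j k
    by (rule basis_measurement_commutes) (simp add: ketbra_orthonormal_mult[OF J])
  then show ?thesis
    unfolding dephase_A_eq_pinching \<rho>
    by (intro pinching_fixed projective_basis_measurement J)
      (simp add: matrix_mult_sum_left matrix_mult_sum_right matrix_scalar_ac flip: scalar_matrix_assoc)
qed

lemma incoherent_state_ketbra: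
  assumes "orthonormal_basis J"
  shows "incoherent_state J (ketbra (J j) (J j))"
proof -
  have J: "cinner (J i) (J k) = (if i = k then 1 else 0)" for i k
    using assms by (simp add: orthonormal_basis_def)
  have "cinner v (ketbra (J j) (J j) *v v) = of_real ((cmod (cinner (J j) v))\<^sup>2)" for v
    using cnj_mult_self(1)[of "cinner (J j) v"]
    by (simp add: ketbra_mult_vec cinner_scale_right cnj_cinner)
  then show ?thesis
    by (simp add: incoherent_state_def density_operator_def diagonal_in_def adj_ketbra trace_ketbra
        ketbra_mult_vec cinner_scale_right J del: of_real_power)
qed

text \<open>A dephased operator is a sum of terms with a basis projector on A. Each incoherent
  \<open>A n\<close> maps such a projector to a diagonal operator, which commutes with the
  measurement.\<close>

lemma SQI_dephase_A_fixed:
  fixes \<rho> :: "('a::finite \<times> 'b::finite) operator"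
  assumes J: "orthonormal_basis J" and A: "\<forall>n\<in>I. incoherent_kraus J (A n)"
  shows "pinching (basis_measurement J) (kraus_map I (\<lambda>n. A n \<otimes>\<^sub>o B n) (dephase_A J \<rho>))
    = kraus_map I (\<lambda>n. A n \<otimes>\<^sub>o B n) (dephase_A J \<rho>)"
proof (rule pinching_fixed[OF projective_basis_measurement[OF J]])
  fix k
  have "\<exists>\<tau>. dephase_A J \<rho> = (\<Sum>j\<in>UNIV. ketbra (J j) (J j) \<otimes>\<^sub>o \<tau> j)"
    unfolding dephase_A_def project_A by (rule exI, rule sum.cong[OF refl], rule refl)
  then obtain \<tau> where \<tau>: "dephase_A J \<rho> = (\<Sum>j\<in>UNIV. ketbra (J j) (J j) \<otimes>\<^sub>o \<tau> j)" ..
  have K: "kraus_map I (\<lambda>n. A n \<otimes>\<^sub>o B n) (dephase_A J \<rho>) = (\<Sum>n\<in>I. \<Sum>j\<in>UNIV.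
      (A n ** ketbra (J j) (J j) ** adj (A n)) \<otimes>\<^sub>o (B n ** \<tau> j ** adj (B n)))"
    by (simp add: \<tau> kraus_map_def matrix_mult_sum_left matrix_mult_sum_right adj_tensor tensor_mult)
  have "basis_measurement J k ** ((A n ** ketbra (J j) (J j) ** adj (A n)) \<otimes>\<^sub>o Y)
      = ((A n ** ketbra (J j) (J j) ** adj (A n)) \<otimes>\<^sub>o Y) ** basis_measurement J k"
    if "n \<in> I" for n j and Y :: "'b operator"
    using A that incoherent_state_ketbra[OF J]
    by (intro basis_measurement_commutes diagonal_in_commutes[OF J]) (simp add: incoherent_kraus_def)
  then show "basis_measurement J k ** kraus_map I (\<lambda>n. A n \<otimes>\<^sub>o B n) (dephase_A J \<rho>)
      = kraus_map I (\<lambda>n. A n \<otimes>\<^sub>o B n) (dephase_A J \<rho>) ** basis_measurement J k"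
    unfolding K by (simp add: matrix_mult_sum_left matrix_mult_sum_right)
qed

lemma SQI_operation_kraus_map:
  assumes "SQI_operation J \<Lambda>"
  obtains I :: "nat set" and A B where "finite I" "\<forall>n\<in>I. incoherent_kraus J (A n)"
    "(\<Sum>n\<in>I. adj (A n \<otimes>\<^sub>o B n) ** (A n \<otimes>\<^sub>o B n)) = mat 1" "\<Lambda> = kraus_map I (\<lambda>n. A n \<otimes>\<^sub>o B n)"
proof -
  obtain N :: nat and A B where "\<forall>n<N. incoherent_kraus J (A n)"
    "(\<Sum>n<N. (adj (A n) ** A n) \<otimes>\<^sub>o (adj (B n) ** B n)) = mat 1"
    "\<forall>\<rho>. \<Lambda> \<rho> = (\<Sum>n<N. (A n \<otimes>\<^sub>o B n) ** \<rho> ** adj (A n \<otimes>\<^sub>o B n))"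
    using assms by (auto simp: SQI_operation_def)
  then show thesis
    by (intro that[of "{..<N}" A B]) (auto simp: fun_eq_iff kraus_map_def adj_tensor tensor_mult)
qed

lemma entropy_gain_SQI_le:
  assumes J: "orthonormal_basis J" and "SQI_operation J \<Lambda>" and "psd \<rho>"
  shows "entropy_gain J (\<Lambda> \<rho>) \<le> entropy_gain J \<rho>"
proof -
  obtain I :: "nat set" and A B where I: "finite I" and A: "\<forall>n\<in>I. incoherent_kraus J (A n)"
    and K: "(\<Sum>n\<in>I. adj (A n \<otimes>\<^sub>o B n) ** (A n \<otimes>\<^sub>o B n)) = mat 1"
    and \<Lambda>: "\<Lambda> = kraus_map I (\<lambda>n. A n \<otimes>\<^sub>o B n)"
    using SQI_operation_kraus_map[OF assms(2)] by blast
  show ?thesis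
    using pinching_entropy_gain_kraus_map[OF projective_basis_measurement[OF J] \<open>psd \<rho>\<close> I K
        SQI_dephase_A_fixed[OF J A, unfolded dephase_A_eq_pinching]]
    by (simp add: entropy_gain_def dephase_A_eq_pinching \<Lambda>)
qed

lemma SQI_operation_density_operator:
  assumes "SQI_operation J \<Lambda>" "density_operator \<rho>"
  shows "density_operator (\<Lambda> \<rho>)"
proof -
  obtain I :: "nat set" and A B where "(\<Sum>n\<in>I. adj (A n \<otimes>\<^sub>o B n) ** (A n \<otimes>\<^sub>o B n)) = mat 1"
    "\<Lambda> = kraus_map I (\<lambda>n. A n \<otimes>\<^sub>o B n)"
    using SQI_operation_kraus_map[OF assms(1)] by blast
  then show ?thesis
    using assms(2) by (simp add: density_operator_iff psd_kraus_map trace_kraus_map)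
qed

text \<open>In the basis \<open>J\<close>, incoherence says that every column of \<open>U\<close> has at most one nonzero entry.
  By orthogonality of the columns of a unitary, so does every row.\<close>

lemma incoherent_unitary_adj:
  assumes J: "orthonormal_basis J" and U: "incoherent_unitary J U"
  shows "incoherent_unitary J (adj U)"
proof -
  have unitary: "unitary_op U" and inc: "incoherent_kraus J U"
    using U by (simp_all add: incoherent_unitary_def)
  define m where "m i k = cinner (J i) (U *v J k)" for i k
  have column: "m i k = 0 \<or> m j k = 0" if "i \<noteq> j" for i j k
  proof -
    have "diagonal_in J (U ** ketbra (J k) (J k) ** adj U)"
      using inc incoherent_state_ketbra[OF J] by (simp add: incoherent_kraus_def)
    then have "cinner (J i) (ketbra (U *v J k) (U *v J k) *v J j) = 0"
      using that by (simp add: mult_ketbra ketbra_mult diagonal_in_def)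
    then have "cnj (m j k) * m i k = 0"
      by (simp add: m_def ketbra_mult_vec cinner_scale_right cnj_cinner)
    then show ?thesis by auto
  qed
  have row: "m j k = 0 \<or> m j l = 0" if "k \<noteq> l" for j k l
  proof (rule ccontr)
    assume nz: "\<not> (m j k = 0 \<or> m j l = 0)"
    have "0 = cinner (U *v J k) (U *v J l)"
      using J that by (simp add: cinner_adj[of _ U] matrix_vector_mul_assoc unitary_opD[OF unitary]
          orthonormal_basis_def)
    also have "U *v J l = (\<Sum>i\<in>UNIV. m i l *s J i)"
      unfolding m_def by (rule orthonormal_basis_expansion[OF J])
    also have "cinner (U *v J k) (\<Sum>i\<in>UNIV. m i l *s J i) = (\<Sum>i\<in>UNIV. m i l * cnj (m i k))"
      by (simp add: m_def cinner_sum_right cinner_scale_right cnj_cinner)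
    \<comment> \<open>As \<open>m j k\<close> is nonzero, \<open>column\<close> leaves only the term
      \<open>i = j\<close>.\<close>
    also have "\<dots> = (\<Sum>i\<in>UNIV. if i = j then m j l * cnj (m j k) else 0)"
      using column[of _ j k] nz by (intro sum.cong refl) auto
    also have "\<dots> = m j l * cnj (m j k)" by simp
    finally show False using nz by simp
  qed
  have "diagonal_in J (adj U ** \<sigma> ** adj (adj U))" if \<sigma>: "incoherent_state J \<sigma>" for \<sigma>
    unfolding diagonal_in_def
  proof (intro allI impI)
    fix k l :: 'a assume "k \<noteq> l"
    define s where "s i = cinner (J i) (\<sigma> *v J i)" for i
    have \<sigma>J: "\<sigma> *v J i = s i *s J i" for i
      using diagonal_in_eigenvector[OF J] \<sigma> by (simp add: s_def incoherent_state_def)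
    have "cinner (J k) ((adj U ** \<sigma> ** adj (adj U)) *v J l) = cinner (U *v J k) (\<sigma> *v (U *v J l))"
      using cinner_conj[of "J k" "adj U" \<sigma> "J l"] by simp
    also have "U *v J l = (\<Sum>i\<in>UNIV. m i l *s J i)"
      unfolding m_def by (rule orthonormal_basis_expansion[OF J])
    also have "cinner (U *v J k) (\<sigma> *v (\<Sum>i\<in>UNIV. m i l *s J i))
        = (\<Sum>i\<in>UNIV. m i l * s i * cnj (m i k))"
      by (simp add: vec.sum vec.scale \<sigma>J m_def cinner_sum_right cinner_scale_right cnj_cinner)
    \<comment> \<open>In each summand \<open>row\<close> makes \<open>m i k\<close> or
      \<open>m i l\<close> vanish.\<close>
    also have "\<dots> = 0"
      using row[OF \<open>k \<noteq> l\<close>] by (intro sum.neutral) auto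
    finally show "cinner (J k) ((adj U ** \<sigma> ** adj (adj U)) *v J l) = 0" .
  qed
  then show ?thesis
    by (simp add: incoherent_unitary_def incoherent_kraus_def unitary_op_adj[OF unitary])
qed

lemma SQI_operation_unitary:
  assumes "incoherent_unitary J U" "unitary_op V"
  shows "SQI_operation J (\<lambda>\<rho>. (U \<otimes>\<^sub>o V) ** \<rho> ** adj (U \<otimes>\<^sub>o V))"
  unfolding SQI_operation_def
  using assms
  by (intro exI[of _ 1] exI[of _ "\<lambda>_. U"] exI[of _ "\<lambda>_. V"])
    (simp add: incoherent_unitary_def unitary_opD tensor_mat_1)

theorem basis_dependent_discord_measure_S_Z_E:
  fixes J :: "'a::finite \<Rightarrow> complex ^ 'a"
  assumes J: "orthonormal_basis J"
  shows "basis_dependent_discord_measure J (S_Z_E J :: ('a \<times> 'b::finite) operator \<Rightarrow> real)"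
proof -
  have mono: "S_Z_E J (\<Lambda> \<rho>) \<le> S_Z_E J \<rho>"
    if "SQI_operation J \<Lambda>" "density_operator \<rho>" for \<Lambda> and \<rho> :: "('a \<times> 'b) operator"
    unfolding S_Z_E_eq[OF J that(2)] S_Z_E_eq[OF J SQI_operation_density_operator[OF that]]
    using entropy_gain_SQI_le[OF J that(1)] that(2) by (simp add: density_operator_iff)
  show ?thesis
    unfolding basis_dependent_discord_measure_def
  proof (intro conjI allI impI)
    fix \<rho> :: "('a \<times> 'b) operator" assume "density_operator \<rho>"
    then show "0 \<le> S_Z_E J \<rho>"
      by (simp add: S_Z_E_eq[OF J] entropy_gain_nonneg[OF J] density_operator_iff)
  next
    fix \<rho> :: "('a \<times> 'b) operator" assume "IQ_state J \<rho>"
    then show "S_Z_E J \<rho> = 0"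
      by (simp add: S_Z_E_eq[OF J] IQ_state_density_operator[OF J] IQ_state_dephase_A[OF J]
          entropy_gain_def)
  next
    fix \<Lambda> :: "('a \<times> 'b) operator \<Rightarrow> ('a \<times> 'b) operator" and \<rho> :: "('a \<times> 'b) operator"
    assume "SQI_operation J \<Lambda>" and "density_operator \<rho>"
    then show "S_Z_E J (\<Lambda> \<rho>) \<le> S_Z_E J \<rho>" by (rule mono)
  next
    fix U and V :: "'b operator" and \<rho> :: "('a \<times> 'b) operator"
    assume U: "incoherent_unitary J U" and V: "unitary_op V" and \<rho>: "density_operator \<rho>"
    let ?\<rho>' = "(U \<otimes>\<^sub>o V) ** \<rho> ** adj (U \<otimes>\<^sub>o V)"
    note op = SQI_operation_unitary[OF U V]
    \<comment> \<open>The inverse conjugation is an SQI operation too, so monotonicity gives both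
      inequalities.\<close>
    note op_inv = SQI_operation_unitary[OF incoherent_unitary_adj[OF J U] unitary_op_adj[OF V]]
    have "adj (U \<otimes>\<^sub>o V) ** (U \<otimes>\<^sub>o V) = mat 1"
      using U V by (simp add: adj_tensor tensor_mult incoherent_unitary_def unitary_opD tensor_mat_1)
    then have "\<rho> = adj (U \<otimes>\<^sub>o V) ** ?\<rho>' ** adj (adj (U \<otimes>\<^sub>o V))"
      by (simp add: matrix_mul_assoc) (simp flip: matrix_mul_assoc)
    then have "S_Z_E J \<rho> \<le> S_Z_E J ?\<rho>'"
      using mono[OF op_inv SQI_operation_density_operator[OF op \<rho>]] by (simp add: adj_tensor)
    moreover have "S_Z_E J ?\<rho>' \<le> S_Z_E J \<rho>" using mono[OF op \<rho>] .
    ultimately show "S_Z_E J ?\<rho>' = S_Z_E J \<rho>" by simp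
  qed
qed

text \<open>The first two conjuncts justify the choices in \<open>S_Z_E\<close>: the
  \<open>SOME\<close> there has a witness, and every purification, with E of any finite dimension,
  gives the same value.\<close>

theorem proposition1:
  fixes J :: "'a::finite \<Rightarrow> complex ^ 'a"
  assumes "orthonormal_basis J"
  shows "(\<forall>\<rho> :: ('a \<times> 'b::finite) operator. density_operator \<rho> \<longrightarrow>
            (\<exists>\<Psi> :: complex ^ ('a \<times> 'b \<times> ('a \<times> 'b)). purification \<Psi> \<rho>)) \<and>
         (\<forall>(\<rho> :: ('a \<times> 'b) operator) (\<Psi> :: complex ^ ('a \<times> 'b \<times> 'e::finite)).
            density_operator \<rho> \<longrightarrow> purification \<Psi> \<rho> \<longrightarrow> entropy_Z_given_E J \<Psi> = S_Z_E J \<rho>) \<and>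
         basis_dependent_discord_measure J (S_Z_E J :: ('a \<times> 'b) operator \<Rightarrow> real)"
  by (auto simp: purification_exists entropy_Z_given_E_eq[OF assms] S_Z_E_eq[OF assms]
      basis_dependent_discord_measure_S_Z_E[OF assms])

end
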